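(* Let $\mathcal{T}_e \subset \mathbb{R}^2$ be the (interior of the) equilateral triangle with sides of length $1$. Then the Extended Courant Property for $\mathcal{T}_e$ with the Neumann boundary condition on $\partial \mathcal{T}_e$ is false; that is, there exist an integer $m \ge 1$ and a linear combination $v$ of Neumann eigenfunctions of $-\Delta$ in $\mathcal{T}_e$ associated with eigenvalues less than or equal to $\lambda_m$ such that $\beta_0(v) > \kappa(\lambda_m)$.
   Context: Let $\Omega$ be a bounded domain, with a self-adjoint realization of $-\Delta$ given by a homogeneous boundary condition $\mathfrak{b}$ (here $\mathfrak{b}=\mathfrak{n}$, the Neumann condition $\frac{\partial u}{\partial \nu}|_{\partial\Omega}=0$). Its eigenvalues are listed in nondecreasing order, counted with multiplicity and starting with index $1$: $\lambda_1 < \lambda_2 \le \lambda_3 \le \cdots$. For an eigenvalue $\lambda$, set $\kappa(\lambda) = \min\{k \mid \lambda_k = \lambda\}$. For $\lambda \ge 0$, let $\mathcal{L}(\Omega,\mathfrak{b},\lambda)$ be the real vector space of linear combinations of real eigenfunctions associated with eigenvalues $\le \lambda$. For a real continuous function $v$ on $\Omega$, the nodal set is $\mathcal{Z}(v) = \overline{\{x \in \Omega \mid v(x) = 0\}}$, and $\beta_0(v)$ denotes the number of connected components of $\Omega \setminus \mathcal{Z}(v)$ (nodal domains). The Extended Courant Property $\mathrm{ECP}(\Omega,\mathfrak{b})$ is the assertion: for every $m \ge 1$ and every $v \in \mathcal{L}(\Omega,\mathfrak{b},\lambda_m)$, one has $\beta_0(v) \le \kappa(\lambda_m) \le m$. Concretely,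 one may take $\mathcal{T}_e$ with vertices $O=(0,0)$, $A=(1,0)$, $B=(\frac12,\frac{\sqrt3}{2})$. *)

theory Defs
  imports
    "HOL-Analysis.Analysis"
    "HOL-Library.Function_Algebras"
    "HOL-Library.Extended_Nat"
begin

global_interpretation fun_vs: vector_space "\<lambda>(c::real) (f::'a \<Rightarrow> real) x. c * f x"
  defines fun_span = fun_vs.span and fun_dependent = fun_vs.dependent
  by unfold_locales (auto simp: fun_eq_iff algebra_simps)

definition square_integrable_on ::
    "('a::euclidean_space \<Rightarrow> 'b::{banach, second_countable_topology}) \<Rightarrow> 'a set \<Rightarrow> bool"
  where "square_integrable_on u \<Omega> \<longleftrightarrow>
    set_borel_measurable lborel \<Omega> u \<and> set_integrable lborel \<Omega> (\<lambda>x. (norm (u x))\<^sup>2)"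

text \<open>Test functions for weak derivatives are \<open>C\<^sup>1\<close> with compact support in \<open>\<Omega>\<close>; by mollification
  this gives the same weak derivatives as \<open>C\<^sup>\<infinity>\<close> test functions.\<close>

definition test_function :: "'a::euclidean_space set \<Rightarrow> ('a \<Rightarrow> real) \<Rightarrow> ('a \<Rightarrow> 'a) \<Rightarrow> bool"
  where "test_function \<Omega> \<phi> g \<longleftrightarrow>
    (\<forall>x. GDERIV \<phi> x :> g x) \<and> continuous_on UNIV g \<and>
    compact (closure {x. \<phi> x \<noteq> 0}) \<and> closure {x. \<phi> x \<noteq> 0} \<subseteq> \<Omega>"

definition weak_gradient :: "'a::euclidean_space set \<Rightarrow> ('a \<Rightarrow> real) \<Rightarrow> ('a \<Rightarrow> 'a) \<Rightarrow> bool"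
  where "weak_gradient \<Omega> u G \<longleftrightarrow>
    (\<forall>\<phi> g. test_function \<Omega> \<phi> g \<longrightarrow>
      (LINT x:\<Omega>|lborel. u x *\<^sub>R g x) = - (LINT x:\<Omega>|lborel. \<phi> x *\<^sub>R G x))"

text \<open>\<open>H1 \<Omega> u G\<close>: \<open>u\<close> represents an element of the Sobolev space \<open>H\<^sup>1(\<Omega>)\<close> and \<open>G\<close> its gradient.\<close>

definition H1 :: "'a::euclidean_space set \<Rightarrow> ('a \<Rightarrow> real) \<Rightarrow> ('a \<Rightarrow> 'a) \<Rightarrow> bool"
  where "H1 \<Omega> u G \<longleftrightarrow>
    square_integrable_on u \<Omega> \<and> square_integrable_on G \<Omega> \<and> weak_gradient \<Omega> u G"

text \<open>The graph of the Neumann realization of \<open>-\<Delta>\<close>: the self-adjoint operator on \<open>L\<^sup>2(\<Omega>)\<close> associated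
  with the Dirichlet form on \<open>H\<^sup>1(\<Omega>)\<close>. Testing against all of \<open>H\<^sup>1(\<Omega>)\<close>, and not only against
  functions vanishing at the boundary, encodes the condition \<open>\<partial>u/\<partial>\<nu> = 0\<close>.\<close>

definition neumann_laplacian :: "'a::euclidean_space set \<Rightarrow> ('a \<Rightarrow> real) \<Rightarrow> ('a \<Rightarrow> real) \<Rightarrow> bool"
  where "neumann_laplacian \<Omega> u f \<longleftrightarrow>
    square_integrable_on f \<Omega> \<and>
    (\<exists>G. H1 \<Omega> u G \<and>
      (\<forall>w W. H1 \<Omega> w W \<longrightarrow>
        (LINT x:\<Omega>|lborel. G x \<bullet> W x) = (LINT x:\<Omega>|lborel. f x * w x)))"

text \<open>An eigenfunction is identified with its continuous representative on \<open>\<Omega>\<close> (which exists by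
  interior elliptic regularity), extended by 0 outside \<open>\<Omega>\<close>. The extension makes the linear
  structure of functions on \<open>\<Omega>\<close> agree with that of \<open>'a \<Rightarrow> real\<close>.\<close>

definition neumann_eigenfunction :: "'a::euclidean_space set \<Rightarrow> real \<Rightarrow> ('a \<Rightarrow> real) \<Rightarrow> bool"
  where "neumann_eigenfunction \<Omega> \<mu> u \<longleftrightarrow>
    continuous_on \<Omega> u \<and> (\<forall>x. x \<notin> \<Omega> \<longrightarrow> u x = 0) \<and> (\<exists>x\<in>\<Omega>. u x \<noteq> 0) \<and>
    neumann_laplacian \<Omega> u (\<lambda>x. \<mu> * u x)"

definition neumann_eigenspace :: "'a::euclidean_space set \<Rightarrow> real \<Rightarrow> ('a \<Rightarrow> real) set"
  where "neumann_eigenspace \<Omega> \<mu> = insert 0 {u. neumann_eigenfunction \<Omega> \<mu> u}"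

text \<open>\<open>lam 1 \<le> lam 2 \<le> \<dots>\<close> lists the Neumann eigenvalues with multiplicity; \<open>lam 0\<close> is irrelevant.
  For \<open>\<mu>\<close> not an eigenvalue the condition says that \<open>\<mu>\<close> is not in the list. Finiteness is explicit
  because \<open>card\<close> is 0 on infinite sets.\<close>

definition neumann_eigenvalue_listing :: "'a::euclidean_space set \<Rightarrow> (nat \<Rightarrow> real) \<Rightarrow> bool"
  where "neumann_eigenvalue_listing \<Omega> lam \<longleftrightarrow>
    mono_on {1..} lam \<and>
    (\<forall>\<mu>. finite {k. 1 \<le> k \<and> lam k = \<mu>} \<and>
      (\<exists>B. finite B \<and> \<not> fun_dependent B \<and> fun_span B = neumann_eigenspace \<Omega> \<mu> \<and>
        card B = card {k. 1 \<le> k \<and> lam k = \<mu>}))"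

definition kappa :: "(nat \<Rightarrow> real) \<Rightarrow> real \<Rightarrow> nat"
  where "kappa lam \<mu> = (LEAST k. 1 \<le> k \<and> lam k = \<mu>)"

definition eigen_combinations :: "'a::euclidean_space set \<Rightarrow> real \<Rightarrow> ('a \<Rightarrow> real) set"
  where "eigen_combinations \<Omega> L = fun_span {u. \<exists>\<mu>\<le>L. neumann_eigenfunction \<Omega> \<mu> u}"

definition nodal_set :: "'a::euclidean_space set \<Rightarrow> ('a \<Rightarrow> real) \<Rightarrow> 'a set"
  where "nodal_set \<Omega> v = closure {x \<in> \<Omega>. v x = 0}"

definition beta0 :: "'a::euclidean_space set \<Rightarrow> ('a \<Rightarrow> real) \<Rightarrow> enat"
  where "beta0 \<Omega> v =
    (let C = components (\<Omega> - nodal_set \<Omega> v) in if finite C then enat (card C) else \<infinity>)"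

text \<open>The listing, when it exists, is unique on indices \<open>\<ge> 1\<close>. Since it is universally quantified
  here, the negation of the property includes the existence of the listing.\<close>

definition neumann_ECP :: "'a::euclidean_space set \<Rightarrow> bool"
  where "neumann_ECP \<Omega> \<longleftrightarrow>
    (\<forall>lam. neumann_eigenvalue_listing \<Omega> lam \<longrightarrow>
      (\<forall>m\<ge>1. \<forall>v\<in>eigen_combinations \<Omega> (lam m).
        beta0 \<Omega> v \<le> enat (kappa lam (lam m)) \<and> kappa lam (lam m) \<le> m))"

definition equilateral_triangle :: "(real \<times> real) set"
  where "equilateral_triangle = interior (convex hull {(0, 0), (1, 0), (1/2, sqrt 3 / 2)})"

end

theory Submission imports Defs
begin

text \<open>
  On the triangle with vertices \<open>(0,0)\<close>, \<open>(1,0)\<close>, \<open>(1/2, \<surd>3/2)\<close> the function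
  \<open>\<phi>(x,y) = cos (4\<pi>x/3) + 2 cos (2\<pi>x/3) cos (2\<pi>y/\<surd>3)\<close> is a Neumann eigenfunction for the eigenvalue
  \<open>16\<pi>\<^sup>2/9\<close>. Adding the constant eigenfunction makes it factor:
  \<open>\<phi> + 1 = 2 cos (2\<pi>x/3) (cos (2\<pi>x/3) + cos (2\<pi>y/\<surd>3))\<close>. It vanishes on the segments \<open>x = 3/4\<close> and
  \<open>x + \<surd>3 y = 3/2\<close> of the triangle, each of which cuts off one corner, so it has three nodal domains
  (\<open>corner_cutting_mode_nodal_domains\<close>). But \<open>16\<pi>\<^sup>2/9\<close> is the second eigenvalue, so the bound of
  the Extended Courant Property is 2.

  Most of the proof establishes that \<open>16\<pi>\<^sup>2/9\<close> is the second eigenvalue of the weak Neumann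
  Laplacian, and that its eigenvalues, each of finite multiplicity, can be listed at all. This rests on
  an explicit complete family of eigenfunctions.

  There are three frequency vectors \<open>a\<close>, \<open>b\<close>, \<open>c\<close> of equal length with \<open>a + b + c = 0\<close>, and the
  plane waves with integer combinations of them as frequencies are permuted by the reflections in the
  sides of the triangle. Sums of waves over the six permutations of the coefficients are therefore
  invariant under these reflections, which makes their gradients tangential to the sides; they are
  eigenfunctions for \<open>16\<pi>\<^sup>2/9\<close> times an integer (\<open>triangle_mode_in_eigenspace\<close>). That a smooth
  solution with tangential gradient satisfies the weak equation against every \<open>H\<^sup>1\<close> function is an
  integration by parts with a cutoff function whose gradient is of the order of the inverse distance
  to the sides, while the normal component of the field is of the order of this distance
  (\<open>integration_by_parts_tangential_field\<close>).

  The symmetric sums span an algebra, because a product of two cosines is a sum of cosines, and they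
  separate the points of the closed triangle, because it is a fundamental domain of the group
  generated by the reflections. By the Stone-Weierstrass theorem a continuous square-integrable
  function orthogonal to all of them is zero (\<open>orthogonal_to_waves_imp_zero\<close>).

  Eigenfunctions for different eigenvalues are orthogonal. Hence an eigenfunction is determined by its
  inner products with the finitely many symmetric sums for the same eigenvalue
  (\<open>eigenspace_orthogonal_imp_zero\<close>). So the eigenspaces are finite dimensional, there are no
  eigenvalues besides the integer multiples of \<open>16\<pi>\<^sup>2/9\<close>, and 0 is simple; this gives the listing
  (\<open>triangle_eigenvalue_listing\<close>).
\<close>

section \<open>Square-integrable functions and the weak Neumann Laplacian\<close>

text \<open>The products that occur in the weak formulation (scalar, scalar times vector, inner product) are
  all integrable for this reason, so the bound is stated once for a general \<open>h\<close>.\<close>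

lemma set_integrable_dominated_by_squares:
  fixes u :: "'a::euclidean_space \<Rightarrow> 'b::{banach, second_countable_topology}"
    and v :: "'a \<Rightarrow> 'c::{banach, second_countable_topology}"
    and h :: "'a \<Rightarrow> 'd::{banach, second_countable_topology}"
  assumes "square_integrable_on u \<Omega>" "square_integrable_on v \<Omega>"
    and "set_borel_measurable lborel \<Omega> h"
    and "\<And>x. norm (h x) \<le> a * (norm (u x))\<^sup>2 + b * (norm (v x))\<^sup>2"
  shows "set_integrable lborel \<Omega> h"
proof -
  have "set_integrable lborel \<Omega> (\<lambda>x. a * (norm (u x))\<^sup>2 + b * (norm (v x))\<^sup>2)"
    using assms(1,2) unfolding square_integrable_on_def by auto
  then show ?thesis
    using assms(3) unfolding set_integrable_def set_borel_measurable_def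
    by (rule Bochner_Integration.integrable_bound)
      (auto simp: indicator_def intro!: AE_I2 order_trans[OF assms(4) abs_ge_self])
qed

text \<open>Measurability of \<open>u\<close> and \<open>v\<close> is only known on the set \<open>A\<close>, so the bilinear map has to be applied to
  the functions cut off outside \<open>A\<close>; the result vanishes there as well.\<close>

lemma set_borel_measurable_bilinear:
  assumes "bounded_bilinear (B :: 'b::{banach,second_countable_topology} \<Rightarrow> 'c::{banach,second_countable_topology} \<Rightarrow> 'd::{banach,second_countable_topology})"
    and "set_borel_measurable M A u" "set_borel_measurable M A v"
  shows "set_borel_measurable M A (\<lambda>x. B (u x) (v x))"
proof -
  interpret bounded_bilinear B by fact
  have c: "continuous_on UNIV (\<lambda>p. B (fst p) (snd p))"
    by (intro continuous_on continuous_intros)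
  have "(\<lambda>x. B (indicator A x *\<^sub>R u x) (indicator A x *\<^sub>R v x)) \<in> borel_measurable M"
    using borel_measurable_continuous_on[OF c, of "\<lambda>x. (indicator A x *\<^sub>R u x, indicator A x *\<^sub>R v x)" M]
      assms(2,3) unfolding set_borel_measurable_def by simp
  also have "(\<lambda>x. B (indicator A x *\<^sub>R u x) (indicator A x *\<^sub>R v x)) = (\<lambda>x. indicator A x *\<^sub>R B (u x) (v x))"
    by (auto simp: indicator_def zero_left zero_right)
  finally show ?thesis unfolding set_borel_measurable_def .
qed

lemma mult_le_half_squares:
  fixes a b :: real
  shows "a * b \<le> 1/2 * a\<^sup>2 + 1/2 * b\<^sup>2"
  using sum_squares_bound[of a b] by simp

lemma square_integrable_product:
  assumes "square_integrable_on u \<Omega>" "square_integrable_on v \<Omega>"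
  shows "set_integrable lborel \<Omega> (\<lambda>x. u x * v x :: real)"
proof (rule set_integrable_dominated_by_squares[OF assms])
  show "norm (u x * v x) \<le> 1/2 * (norm (u x))\<^sup>2 + 1/2 * (norm (v x))\<^sup>2" for x
    using mult_le_half_squares[of "norm (u x)" "norm (v x)"] by (simp only: norm_mult)
qed (use assms in \<open>auto simp: square_integrable_on_def intro: set_borel_measurable_bilinear bounded_bilinear_mult\<close>)

lemma square_integrable_scaleR:
  assumes "square_integrable_on u \<Omega>" "square_integrable_on v \<Omega>"
  shows "set_integrable lborel \<Omega> (\<lambda>x. u x *\<^sub>R v x)"
proof (rule set_integrable_dominated_by_squares[OF assms])
  show "norm (u x *\<^sub>R v x) \<le> 1/2 * (norm (u x))\<^sup>2 + 1/2 * (norm (v x))\<^sup>2" for x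
    using mult_le_half_squares[of "norm (u x)" "norm (v x)"] by simp
qed (use assms in \<open>auto simp: square_integrable_on_def intro: set_borel_measurable_bilinear bounded_bilinear_scaleR\<close>)

lemma square_integrable_inner:
  fixes u v :: "'a::euclidean_space \<Rightarrow> 'b::euclidean_space"
  assumes "square_integrable_on u \<Omega>" "square_integrable_on v \<Omega>"
  shows "set_integrable lborel \<Omega> (\<lambda>x. u x \<bullet> v x)"
proof (rule set_integrable_dominated_by_squares[OF assms])
  show "norm (u x \<bullet> v x) \<le> 1/2 * (norm (u x))\<^sup>2 + 1/2 * (norm (v x))\<^sup>2" for x
    using mult_le_half_squares[of "norm (u x)" "norm (v x)"] Cauchy_Schwarz_ineq2[of "u x" "v x"] by simp
qed (use assms in \<open>auto simp: square_integrable_on_def intro: set_borel_measurable_bilinear bounded_bilinear_inner\<close>)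

lemma square_integrable_on_lincomb:
  assumes u: "square_integrable_on u \<Omega>" and v: "square_integrable_on v \<Omega>"
  shows "square_integrable_on (\<lambda>x. u x + c *\<^sub>R v x) \<Omega>"
proof -
  have m: "set_borel_measurable lborel \<Omega> (\<lambda>x. u x + c *\<^sub>R v x)"
  proof -
    have "(\<lambda>x. indicator \<Omega> x *\<^sub>R u x + c *\<^sub>R (indicator \<Omega> x *\<^sub>R v x)) \<in> borel_measurable lborel"
      by (rule borel_measurable_add[OF _ borel_measurable_scaleR[OF borel_measurable_const]])
        (use u v in \<open>simp_all add: square_integrable_on_def set_borel_measurable_def\<close>)
    then show ?thesis
      unfolding set_borel_measurable_def by (simp add: scaleR_add_right mult.commute)
  qed
  have m2: "set_borel_measurable lborel \<Omega> (\<lambda>x. (norm (u x + c *\<^sub>R v x))\<^sup>2)"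
  proof -
    have "(\<lambda>x. (norm (indicator \<Omega> x *\<^sub>R (u x + c *\<^sub>R v x)))\<^sup>2) \<in> borel_measurable lborel"
      using m unfolding set_borel_measurable_def by measurable
    then show ?thesis
      unfolding set_borel_measurable_def
      by (rule measurable_cong[THEN iffD1, rotated]) (simp add: indicator_def)
  qed
  have "set_integrable lborel \<Omega> (\<lambda>x. (norm (u x + c *\<^sub>R v x))\<^sup>2)"
  proof (rule set_integrable_dominated_by_squares[OF u v m2])
    fix x
    have "(norm (u x + c *\<^sub>R v x))\<^sup>2 \<le> (norm (u x) + \<bar>c\<bar> * norm (v x))\<^sup>2"
      using norm_triangle_ineq[of "u x" "c *\<^sub>R v x"] by (intro power_mono) auto
    also have "\<dots> \<le> 2 * (norm (u x))\<^sup>2 + (2 * c\<^sup>2) * (norm (v x))\<^sup>2"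
      using sum_squares_bound[of "norm (u x)" "\<bar>c\<bar> * norm (v x)"]
      by (simp add: power2_sum power_mult_distrib)
    finally show "norm ((norm (u x + c *\<^sub>R v x))\<^sup>2) \<le> 2 * (norm (u x))\<^sup>2 + (2 * c\<^sup>2) * (norm (v x))\<^sup>2"
      by simp
  qed
  with m show ?thesis unfolding square_integrable_on_def by blast
qed

lemma square_integrable_on_continuous:
  fixes f :: "'a::euclidean_space \<Rightarrow> 'b::{banach, second_countable_topology}"
  assumes "bounded \<Omega>" "\<Omega> \<in> sets borel" "continuous_on UNIV f"
  shows "square_integrable_on f \<Omega>"
proof -
  have int: "set_integrable lborel \<Omega> h" if "continuous_on UNIV h" for h :: "'a \<Rightarrow> real"
  proof (rule set_integrable_subset)
    show "set_integrable lborel (closure \<Omega>) h"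
      unfolding set_integrable_def using assms(1) that
      by (intro borel_integrable_compact) (auto intro: continuous_on_subset)
  qed (use assms closure_subset in auto)
  have "f \<in> borel_measurable borel"
    using assms(3) by (rule borel_measurable_continuous_onI)
  then have "set_borel_measurable lborel \<Omega> f"
    using assms(2) unfolding set_borel_measurable_def by simp
  moreover have "set_integrable lborel \<Omega> (\<lambda>x. (norm (f x))\<^sup>2)"
    by (intro int continuous_intros assms)
  ultimately show ?thesis unfolding square_integrable_on_def by blast
qed

lemma square_integrable_on_cong:
  assumes "\<And>x. x \<in> \<Omega> \<Longrightarrow> u x = v x" "square_integrable_on u \<Omega>"
  shows "square_integrable_on v \<Omega>"
proof -
  have "(\<lambda>x. indicator \<Omega> x *\<^sub>R u x) = (\<lambda>x. indicator \<Omega> x *\<^sub>R v x)"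
    "(\<lambda>x. indicator \<Omega> x *\<^sub>R (norm (u x))\<^sup>2) = (\<lambda>x. indicator \<Omega> x *\<^sub>R (norm (v x))\<^sup>2)"
    using assms(1) by (auto simp: indicator_def fun_eq_iff)
  then show ?thesis
    using assms(2) unfolding square_integrable_on_def set_borel_measurable_def set_integrable_def by simp
qed

lemma square_integrable_on_imp_integrable:
  fixes u :: "'a::euclidean_space \<Rightarrow> real"
  assumes "bounded \<Omega>" "\<Omega> \<in> sets borel" "square_integrable_on u \<Omega>"
  shows "set_integrable lborel \<Omega> u"
  using square_integrable_product[OF assms(3) square_integrable_on_continuous[OF assms(1,2), of "\<lambda>_. 1"]]
  by simp

lemma test_function_square_integrable:
  assumes "bounded \<Omega>" "\<Omega> \<in> sets borel" "test_function \<Omega> \<phi> g"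
  shows "square_integrable_on \<phi> \<Omega>" "square_integrable_on g \<Omega>"
proof -
  have "continuous_on UNIV \<phi>"
    using assms(3)
    by (auto simp: test_function_def gderiv_def continuous_on_eq_continuous_at dest: has_derivative_continuous)
  then show "square_integrable_on \<phi> \<Omega>" "square_integrable_on g \<Omega>"
    using assms square_integrable_on_continuous unfolding test_function_def by blast+
qed

lemma H1_lincomb:
  assumes \<Omega>: "bounded \<Omega>" "\<Omega> \<in> sets borel" and u: "H1 \<Omega> u G" and v: "H1 \<Omega> v K"
  shows "H1 \<Omega> (\<lambda>x. u x + c * v x) (\<lambda>x. G x + c *\<^sub>R K x)"
proof -
  have "weak_gradient \<Omega> (\<lambda>x. u x + c * v x) (\<lambda>x. G x + c *\<^sub>R K x)"
    unfolding weak_gradient_def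
  proof (intro allI impI)
    fix \<phi> g assume t: "test_function \<Omega> \<phi> g"
    note i = test_function_square_integrable[OF \<Omega> t]
    have 1: "set_integrable lborel \<Omega> (\<lambda>x. u x *\<^sub>R g x)" "set_integrable lborel \<Omega> (\<lambda>x. v x *\<^sub>R g x)"
      "set_integrable lborel \<Omega> (\<lambda>x. \<phi> x *\<^sub>R G x)" "set_integrable lborel \<Omega> (\<lambda>x. \<phi> x *\<^sub>R K x)"
      using u v i by (auto simp: H1_def intro: square_integrable_scaleR)
    have "(LINT x:\<Omega>|lborel. (u x + c * v x) *\<^sub>R g x) =
        (LINT x:\<Omega>|lborel. u x *\<^sub>R g x + c *\<^sub>R (v x *\<^sub>R g x))"
      by (simp add: algebra_simps)
    also have "\<dots> = (LINT x:\<Omega>|lborel. u x *\<^sub>R g x) + c *\<^sub>R (LINT x:\<Omega>|lborel. v x *\<^sub>R g x)"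
      using 1 by (simp del: scaleR_scaleR)
    also have "\<dots> = - (LINT x:\<Omega>|lborel. \<phi> x *\<^sub>R G x) + c *\<^sub>R (- (LINT x:\<Omega>|lborel. \<phi> x *\<^sub>R K x))"
      using u v t by (simp add: H1_def weak_gradient_def)
    also have "\<dots> = - ((LINT x:\<Omega>|lborel. \<phi> x *\<^sub>R G x + c *\<^sub>R (\<phi> x *\<^sub>R K x)))"
      using 1 by (simp del: scaleR_scaleR)
    also have "\<dots> = - (LINT x:\<Omega>|lborel. \<phi> x *\<^sub>R (G x + c *\<^sub>R K x))"
      by (simp add: algebra_simps)
    finally show "(LINT x:\<Omega>|lborel. (u x + c * v x) *\<^sub>R g x) = - (LINT x:\<Omega>|lborel. \<phi> x *\<^sub>R (G x + c *\<^sub>R K x))" .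
  qed
  then show ?thesis
    using u v square_integrable_on_lincomb[of u \<Omega> v c] square_integrable_on_lincomb[of G \<Omega> K c]
    unfolding H1_def by simp
qed

lemma neumann_laplacian_lincomb:
  assumes \<Omega>: "bounded \<Omega>" "\<Omega> \<in> sets borel"
    and "neumann_laplacian \<Omega> u f" "neumann_laplacian \<Omega> v h"
  shows "neumann_laplacian \<Omega> (\<lambda>x. u x + c * v x) (\<lambda>x. f x + c * h x)"
proof -
  from assms obtain G K where f: "square_integrable_on f \<Omega>" and h: "square_integrable_on h \<Omega>"
    and G: "H1 \<Omega> u G" "\<And>w W. H1 \<Omega> w W \<Longrightarrow> (LINT x:\<Omega>|lborel. G x \<bullet> W x) = (LINT x:\<Omega>|lborel. f x * w x)"
    and K: "H1 \<Omega> v K" "\<And>w W. H1 \<Omega> w W \<Longrightarrow> (LINT x:\<Omega>|lborel. K x \<bullet> W x) = (LINT x:\<Omega>|lborel. h x * w x)"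
    unfolding neumann_laplacian_def by blast
  have "(LINT x:\<Omega>|lborel. (G x + c *\<^sub>R K x) \<bullet> W x) = (LINT x:\<Omega>|lborel. (f x + c * h x) * w x)"
    if w: "H1 \<Omega> w W" for w W
  proof -
    have 1: "set_integrable lborel \<Omega> (\<lambda>x. G x \<bullet> W x)" "set_integrable lborel \<Omega> (\<lambda>x. K x \<bullet> W x)"
      "set_integrable lborel \<Omega> (\<lambda>x. f x * w x)" "set_integrable lborel \<Omega> (\<lambda>x. h x * w x)"
      using w f h G(1) K(1) by (auto simp: H1_def intro: square_integrable_inner square_integrable_product)
    have "(LINT x:\<Omega>|lborel. (G x + c *\<^sub>R K x) \<bullet> W x) = (LINT x:\<Omega>|lborel. G x \<bullet> W x + c * (K x \<bullet> W x))"
      by (simp add: algebra_simps)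
    also have "\<dots> = (LINT x:\<Omega>|lborel. f x * w x) + c * (LINT x:\<Omega>|lborel. h x * w x)"
      using 1 by (simp add: G(2)[OF w] K(2)[OF w])
    also have "\<dots> = (LINT x:\<Omega>|lborel. f x * w x + c * (h x * w x))"
      using 1 by simp
    finally show ?thesis by (simp add: algebra_simps)
  qed
  then show ?thesis
    unfolding neumann_laplacian_def
    using H1_lincomb[OF \<Omega> G(1) K(1), of c] square_integrable_on_lincomb[OF f h, of c]
    by (auto intro!: exI[of _ "\<lambda>x. G x + c *\<^sub>R K x"])
qed

lemma neumann_laplacian_zero:
  fixes \<Omega> :: "'a::euclidean_space set"
  assumes \<Omega>: "bounded \<Omega>" "\<Omega> \<in> sets borel"
  shows "neumann_laplacian \<Omega> (\<lambda>x. 0) (\<lambda>x. 0)"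
proof -
  have "H1 \<Omega> (\<lambda>x. 0) (\<lambda>x. 0)"
    unfolding H1_def weak_gradient_def
    using square_integrable_on_continuous[OF \<Omega>, of "\<lambda>x. 0::real"]
      square_integrable_on_continuous[OF \<Omega>, of "\<lambda>x. 0::'a"] by (simp add: set_lebesgue_integral_def)
  then show ?thesis
    unfolding neumann_laplacian_def
    using square_integrable_on_continuous[OF \<Omega>, of "\<lambda>x. 0::real"]
    by (auto simp: set_lebesgue_integral_def)
qed

text \<open>The zero function satisfies the eigenvalue equation, so the definition by cases collapses to a
  linear condition.\<close>

lemma neumann_eigenspace_eq:
  fixes \<Omega> :: "'a::euclidean_space set"
  assumes \<Omega>: "bounded \<Omega>" "\<Omega> \<in> sets borel"
  shows "neumann_eigenspace \<Omega> \<mu> = {u. continuous_on \<Omega> u \<and> (\<forall>x. x \<notin> \<Omega> \<longrightarrow> u x = 0) \<and>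
    neumann_laplacian \<Omega> u (\<lambda>x. \<mu> * u x)}" (is "_ = ?R")
proof -
  have "0 \<in> ?R"
    using neumann_laplacian_zero[OF \<Omega>] by (simp add: zero_fun_def)
  moreover have "u \<in> insert 0 {u. neumann_eigenfunction \<Omega> \<mu> u}" if "u \<in> ?R" for u
  proof (cases "\<exists>x\<in>\<Omega>. u x \<noteq> 0")
    case False
    with that have "u = 0" by (auto simp: fun_eq_iff)
    then show ?thesis by simp
  qed (use that in \<open>auto simp: neumann_eigenfunction_def\<close>)
  moreover have "{u. neumann_eigenfunction \<Omega> \<mu> u} \<subseteq> ?R"
    by (auto simp: neumann_eigenfunction_def)
  ultimately show ?thesis
    unfolding neumann_eigenspace_def by blast
qed

lemma subspace_neumann_eigenspace:
  fixes \<Omega> :: "'a::euclidean_space set"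
  assumes \<Omega>: "bounded \<Omega>" "\<Omega> \<in> sets borel"
  shows "fun_vs.subspace (neumann_eigenspace \<Omega> \<mu>)"
proof -
  have lin: "(\<lambda>x. u x + c * v x) \<in> neumann_eigenspace \<Omega> \<mu>"
    if "u \<in> neumann_eigenspace \<Omega> \<mu>" "v \<in> neumann_eigenspace \<Omega> \<mu>" for u v c
    using that neumann_laplacian_lincomb[OF \<Omega>, of u "\<lambda>x. \<mu> * u x" v "\<lambda>x. \<mu> * v x" c]
    unfolding neumann_eigenspace_eq[OF \<Omega>]
    by (auto intro!: continuous_intros simp: algebra_simps)
  have "0 \<in> neumann_eigenspace \<Omega> \<mu>"
    by (simp add: neumann_eigenspace_def)
  with lin[of _ _ 1] lin[of 0] show ?thesis
    unfolding fun_vs.subspace_def by (simp add: plus_fun_def)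
qed

text \<open>Both sides are the Dirichlet form of \<open>u\<close> and \<open>v\<close>: each function serves as the test function in the
  equation of the other.\<close>

lemma neumann_laplacian_symmetric:
  assumes "neumann_laplacian \<Omega> u f" "neumann_laplacian \<Omega> v h"
  shows "(LINT x:\<Omega>|lborel. f x * v x) = (LINT x:\<Omega>|lborel. h x * u x)"
proof -
  from assms obtain G K where
    G: "H1 \<Omega> u G" "\<And>w W. H1 \<Omega> w W \<Longrightarrow> (LINT x:\<Omega>|lborel. G x \<bullet> W x) = (LINT x:\<Omega>|lborel. f x * w x)"
    and K: "H1 \<Omega> v K" "\<And>w W. H1 \<Omega> w W \<Longrightarrow> (LINT x:\<Omega>|lborel. K x \<bullet> W x) = (LINT x:\<Omega>|lborel. h x * w x)"
    unfolding neumann_laplacian_def by blast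
  show ?thesis
    using G(2)[OF K(1)] K(2)[OF G(1)] by (simp add: inner_commute)
qed

lemma neumann_eigenfunctions_orthogonal:
  assumes "neumann_laplacian \<Omega> u (\<lambda>x. \<mu> * u x)" "neumann_laplacian \<Omega> v (\<lambda>x. \<nu> * v x)" "\<mu> \<noteq> \<nu>"
  shows "(LINT x:\<Omega>|lborel. u x * v x) = 0"
proof -
  have "\<mu> * (LINT x:\<Omega>|lborel. u x * v x) = \<nu> * (LINT x:\<Omega>|lborel. u x * v x)"
    using neumann_laplacian_symmetric[OF assms(1,2)]
    by (simp add: mult.assoc mult.commute[of "u _"])
  with assms(3) show ?thesis by simp
qed

section \<open>Classical gradients are weak gradients\<close>

lemma gderiv_outside_support:
  fixes \<psi> :: "'a::euclidean_space \<Rightarrow> real"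
  assumes "\<And>x. GDERIV \<psi> x :> g x" "x \<notin> closure {x. \<psi> x \<noteq> 0}"
  shows "g x = 0"
proof -
  have op: "open (- closure {x. \<psi> x \<noteq> 0})"
    by (intro open_Compl closed_closure)
  have "((\<lambda>_. 0) has_derivative (\<lambda>_. 0)) (at x)"
    by simp
  then have "(\<psi> has_derivative (\<lambda>_. 0)) (at x)"
    by (rule has_derivative_transform_within_open[OF _ op])
      (use assms(2) closure_subset[of "{x. \<psi> x \<noteq> 0}"] in auto)
  moreover have "(\<psi> has_derivative (\<lambda>h. h \<bullet> g x)) (at x)"
    using assms(1) unfolding gderiv_def by simp
  ultimately have "(\<lambda>h. h \<bullet> g x) = (\<lambda>_. 0)"
    using has_derivative_unique by blast
  then show ?thesis
    by (metis inner_eq_zero_iff)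
qed

text \<open>Translations preserve Lebesgue measure, so every difference quotient of \<open>\<psi>\<close> has integral zero. The
  quotients are uniformly bounded and supported in a fixed ball, and dominated convergence passes to
  the directional derivative.\<close>

lemma integral_gradient_compact_support:
  fixes \<psi> :: "'a::euclidean_space \<Rightarrow> real"
  assumes der: "\<And>x. GDERIV \<psi> x :> g x" and cont: "continuous_on UNIV g"
    and comp: "compact (closure {x. \<psi> x \<noteq> 0})"
  shows "integrable lborel g" "integral\<^sup>L lborel g = 0"
proof -
  define K where "K = closure {x. \<psi> x \<noteq> 0}"
  have compK: "compact K"
    using comp by (simp add: K_def)
  have g0: "g x = 0" if "x \<notin> K" for x
    using gderiv_outside_support[OF der] that unfolding K_def by blast
  have psi0: "\<psi> x = 0" if "x \<notin> K" for x
    using that closure_subset[of "{x. \<psi> x \<noteq> 0}"] unfolding K_def by blast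
  have contpsi: "continuous_on UNIV \<psi>"
    using der by (auto simp: gderiv_def continuous_on_eq_continuous_at dest: has_derivative_continuous)
  have "integrable lborel (\<lambda>x. indicator K x *\<^sub>R g x)" "integrable lborel (\<lambda>x. indicator K x *\<^sub>R \<psi> x)"
    by (rule borel_integrable_compact[OF compK], rule continuous_on_subset, rule cont contpsi, simp)+
  moreover have "(\<lambda>x. indicator K x *\<^sub>R g x) = g" "(\<lambda>x. indicator K x *\<^sub>R \<psi> x) = \<psi>"
    using g0 psi0 by (auto simp: fun_eq_iff indicator_def)
  ultimately have ig: "integrable lborel g" and ipsi: "integrable lborel \<psi>"
    by simp_all
  show "integrable lborel g"
    by (rule ig)
  obtain M where M: "\<And>x. norm (g x) \<le> M" and "M \<ge> 0"
  proof -
    have "compact (g ` K)"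
      using compK cont by (intro compact_continuous_image) (auto intro: continuous_on_subset)
    then obtain b where b: "b > 0" "\<forall>y\<in>g ` K. norm y \<le> b"
      using compact_imp_bounded bounded_pos by blast
    show ?thesis
      by (rule that[of b]) (metis b g0 image_eqI norm_zero less_imp_le, use b in simp)
  qed
  obtain R where R: "\<And>x. x \<in> K \<Longrightarrow> norm x \<le> R"
    using compact_imp_bounded[OF compK] unfolding bounded_iff by blast
  have "integral\<^sup>L lborel g \<bullet> e = 0" if e: "e \<in> Basis" for e
  proof -
    define t :: "nat \<Rightarrow> real" where "t n = 1 / real (Suc n)" for n
    have t: "t n > 0" "t n \<le> 1" for n
      by (auto simp: t_def)
    have t0: "t \<longlonglongrightarrow> 0"
      unfolding t_def using LIMSEQ_inverse_real_of_nat by (simp add: inverse_eq_divide)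
    \<comment> \<open>difference quotients in the direction \<open>e\<close>; the steps are at most 1, which keeps their supports bounded\<close>
    define q where "q n x = (\<psi> (x + t n *\<^sub>R e) - \<psi> x) / t n" for n x
    have lip: "\<bar>\<psi> (x + h) - \<psi> x\<bar> \<le> M * norm h" for x h
    proof -
      have "norm (\<psi> (x + h) - \<psi> x) \<le> M * norm (x + h - x)"
      proof (rule differentiable_bound[where S = UNIV and f' = "\<lambda>x h. h \<bullet> g x"])
        show "(\<psi> has_derivative (\<lambda>h. h \<bullet> g x)) (at x within UNIV)" for x
          using der by (simp add: gderiv_def)
        show "onorm (\<lambda>h. h \<bullet> g x) \<le> M" for x
        proof (rule onorm_le)
          fix h
          show "norm (h \<bullet> g x) \<le> M * norm h"
            using Cauchy_Schwarz_ineq2[of h "g x"] mult_left_mono[OF M[of x], of "norm h"]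
            by (simp add: mult.commute)
        qed
      qed auto
      then show ?thesis by simp
    qed
    have bound: "norm (q n x) \<le> M * indicator (cball 0 (R + 1)) x" for n x
    proof (cases "x \<in> cball 0 (R + 1)")
      case True
      have "\<bar>q n x\<bar> = \<bar>\<psi> (x + t n *\<^sub>R e) - \<psi> x\<bar> / t n"
        using t(1)[of n] by (simp add: q_def)
      also have "\<dots> \<le> M"
        using lip[of x "t n *\<^sub>R e"] t(1)[of n] e by (simp add: divide_le_eq)
      finally show ?thesis
        using True by simp
    next
      case False
      have "x \<notin> K"
        using False R[of x] by auto
      moreover have "x + t n *\<^sub>R e \<notin> K"
      proof
        assume "x + t n *\<^sub>R e \<in> K"
        then have 1: "norm (x + t n *\<^sub>R e) \<le> R" by (rule R)
        have 2: "norm (t n *\<^sub>R e) \<le> 1" using t[of n] e by simp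
        have "norm (x + t n *\<^sub>R e - t n *\<^sub>R e) \<le> R + 1"
          by (rule order_trans[OF norm_triangle_ineq4 add_mono[OF 1 2]])
        then show False using False by simp
      qed
      ultimately show ?thesis
        using psi0 \<open>M \<ge> 0\<close> by (simp add: q_def)
    qed
    have lim: "(\<lambda>n. q n x) \<longlonglongrightarrow> g x \<bullet> e" for x
    proof -
      have "((\<lambda>s. \<psi> (x + s *\<^sub>R e)) has_real_derivative (e \<bullet> g x)) (at 0)"
      proof -
        have "(\<psi> has_derivative (\<lambda>h. h \<bullet> g x)) (at (x + 0 *\<^sub>R e))"
          using der[of x] by (simp add: gderiv_def)
        moreover have "((\<lambda>s. x + s *\<^sub>R e) has_derivative (\<lambda>s. s *\<^sub>R e)) (at 0)"
          by (auto intro!: derivative_eq_intros)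
        ultimately have "((\<lambda>s. \<psi> (x + s *\<^sub>R e)) has_derivative (\<lambda>s. (s *\<^sub>R e) \<bullet> g x)) (at 0)"
          using has_derivative_compose by blast
        then show ?thesis
          by (simp add: has_field_derivative_def mult.commute[of _ "e \<bullet> g x"] mult_commute_abs)
      qed
      then have "((\<lambda>s. (\<psi> (x + s *\<^sub>R e) - \<psi> x) / s) \<longlongrightarrow> e \<bullet> g x) (at 0)"
        by (simp add: has_field_derivative_iff)
      moreover have "filterlim t (at 0) sequentially"
        using t0 t(1) by (simp add: filterlim_at less_imp_neq[symmetric])
      ultimately show ?thesis
        unfolding q_def by (subst inner_commute) (rule filterlim_compose)
    qed
    have ishift: "integrable lborel (\<lambda>x. \<psi> (x + h))" "integral\<^sup>L lborel (\<lambda>x. \<psi> (x + h)) = integral\<^sup>L lborel \<psi>" for h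
    proof -
      have d: "lborel = distr lborel borel ((+) h)"
        by (simp add: lborel_distr_plus)
      have m: "\<psi> \<in> borel_measurable borel"
        using contpsi by (rule borel_measurable_continuous_onI)
      have s: "(+) h \<in> measurable lborel borel"
        by simp
      have "integrable (distr lborel borel ((+) h)) \<psi>"
        using ipsi d by metis
      then show "integrable lborel (\<lambda>x. \<psi> (x + h))"
        by (simp only: integrable_distr_eq[OF s m] add.commute[of h])
      have "integral\<^sup>L lborel \<psi> = integral\<^sup>L (distr lborel borel ((+) h)) \<psi>"
        using d by metis
      then show "integral\<^sup>L lborel (\<lambda>x. \<psi> (x + h)) = integral\<^sup>L lborel \<psi>"
        by (simp only: integral_distr[OF s m] add.commute[of h])
    qed
    have q0: "integral\<^sup>L lborel (q n) = 0" for n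
      unfolding q_def using ishift[of "t n *\<^sub>R e"] ipsi by simp
    have "(\<lambda>n. integral\<^sup>L lborel (q n)) \<longlonglongrightarrow> integral\<^sup>L lborel (\<lambda>x. g x \<bullet> e)"
    proof (rule integral_dominated_convergence[where w = "\<lambda>x. M * indicator (cball 0 (R + 1)) x"])
      show "(\<lambda>x. g x \<bullet> e) \<in> borel_measurable lborel"
        using ig by auto
      show "q n \<in> borel_measurable lborel" for n
        unfolding q_def using ishift(1)[of "t n *\<^sub>R e"] ipsi by (intro borel_measurable_divide borel_measurable_diff) auto
      show "integrable lborel (\<lambda>x::'a. M * indicator (cball 0 (R + 1)) x)"
        using emeasure_lborel_cball_finite[of "0::'a" "R + 1"]
        by (intro integrable_mult_right integrable_real_indicator) (simp_all add: infinity_ennreal_def)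
    qed (use bound lim in auto)
    then have "integral\<^sup>L lborel (\<lambda>x. g x \<bullet> e) = 0"
      unfolding q0 using LIMSEQ_unique tendsto_const by blast
    then show ?thesis
      using ig by simp
  qed
  then show "integral\<^sup>L lborel g = 0"
    using euclidean_eqI[of "integral\<^sup>L lborel g" 0] by (simp only: inner_zero_left)
qed

text \<open>For a test function \<open>\<phi>\<close> the product \<open>f \<phi>\<close> is a \<open>C\<^sup>1\<close> function with compact support on the whole
  space, and the integral of its gradient vanishes.\<close>

lemma gderiv_imp_weak_gradient:
  fixes f :: "'a::euclidean_space \<Rightarrow> real"
  assumes \<Omega>: "bounded \<Omega>" "\<Omega> \<in> sets borel"
    and der: "\<And>x. GDERIV f x :> F x" and cont: "continuous_on UNIV F"
  shows "weak_gradient \<Omega> f F"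
  unfolding weak_gradient_def
proof (intro allI impI)
  fix \<phi> g assume t: "test_function \<Omega> \<phi> g"
  let ?K = "closure {x. \<phi> x \<noteq> 0}"
  have dphi: "\<And>x. GDERIV \<phi> x :> g x" and cg: "continuous_on UNIV g" and K: "compact ?K" "?K \<subseteq> \<Omega>"
    using t by (auto simp: test_function_def)
  have cphi: "continuous_on UNIV \<phi>" and cf: "continuous_on UNIV f"
    using dphi der by (auto simp: gderiv_def continuous_on_eq_continuous_at dest: has_derivative_continuous)
  have sub: "closure {x. f x * \<phi> x \<noteq> 0} \<subseteq> ?K"
    by (intro closure_mono) auto
  have "compact (closure {x. f x * \<phi> x \<noteq> 0})"
    using compact_Int_closed[OF K(1) closed_closure, of "{x. f x * \<phi> x \<noteq> 0}"] sub
    by (simp add: Int_absorb1)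
  then have "integral\<^sup>L lborel (\<lambda>x. f x *\<^sub>R g x + \<phi> x *\<^sub>R F x) = 0"
    by (intro integral_gradient_compact_support(2)[where \<psi> = "\<lambda>x. f x * \<phi> x"] GDERIV_mult der dphi
        continuous_intros cont cphi cf cg)
  also have "(\<lambda>x. f x *\<^sub>R g x + \<phi> x *\<^sub>R F x) = (\<lambda>x. indicator \<Omega> x *\<^sub>R (f x *\<^sub>R g x + \<phi> x *\<^sub>R F x))"
  proof
    fix x
    show "f x *\<^sub>R g x + \<phi> x *\<^sub>R F x = indicator \<Omega> x *\<^sub>R (f x *\<^sub>R g x + \<phi> x *\<^sub>R F x)"
    proof (cases "x \<in> \<Omega>")
      case False
      then have "x \<notin> ?K" using K(2) by blast
      then have "g x = 0" "\<phi> x = 0"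
        using gderiv_outside_support[OF dphi] closure_subset[of "{x. \<phi> x \<noteq> 0}"] by auto
      then show ?thesis by simp
    qed simp
  qed
  finally have "(LINT x:\<Omega>|lborel. f x *\<^sub>R g x + \<phi> x *\<^sub>R F x) = 0"
    by (simp add: set_lebesgue_integral_def)
  moreover have "set_integrable lborel \<Omega> (\<lambda>x. f x *\<^sub>R g x)" "set_integrable lborel \<Omega> (\<lambda>x. \<phi> x *\<^sub>R F x)"
    using test_function_square_integrable[OF \<Omega> t] square_integrable_on_continuous[OF \<Omega>] cf cont
    by (auto intro!: square_integrable_scaleR)
  ultimately show "(LINT x:\<Omega>|lborel. f x *\<^sub>R g x) = - (LINT x:\<Omega>|lborel. \<phi> x *\<^sub>R F x)"
    by (simp add: eq_neg_iff_add_eq_0)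
qed

section \<open>Cutoff functions for polytopes\<close>

text \<open>A \<open>C\<^sup>1\<close> function of the distance \<open>t\<close> to a side that vanishes for \<open>t \<le> e\<close> and, for fixed
  \<open>t > 0\<close>, tends to 1 as \<open>e\<close> tends to 0. The rational form makes both this limit and the bound on \<open>t\<close> times the slope
  elementary.\<close>

definition cutoff :: "real \<Rightarrow> real \<Rightarrow> real"
  where "cutoff e t = (max 0 (t - e))\<^sup>2 / ((max 0 (t - e))\<^sup>2 + e\<^sup>2)"

text \<open>The derivative of \<open>cutoff e\<close>.\<close>

definition cutoff_slope :: "real \<Rightarrow> real \<Rightarrow> real"
  where "cutoff_slope e t = 2 * max 0 (t - e) * e\<^sup>2 / ((max 0 (t - e))\<^sup>2 + e\<^sup>2)\<^sup>2"

text \<open>Squaring removes the kink of the positive part: at 0 the difference quotient is at most \<open>\<bar>h\<bar>\<close>.\<close>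

lemma has_real_derivative_max_square:
  "((\<lambda>t::real. (max 0 (t - e))\<^sup>2) has_real_derivative 2 * max 0 (t - e)) (at t)"
proof -
  have *: "((\<lambda>t::real. (max 0 t)\<^sup>2) has_real_derivative 2 * max 0 t) (at t)" for t
  proof -
    consider "t > 0" | "t < 0" | "t = 0" by linarith
    then show ?thesis
    proof cases
      case 1
      have "((\<lambda>t::real. t\<^sup>2) has_real_derivative 2 * max 0 t) (at t)"
        using 1 by (auto intro!: derivative_eq_intros)
      then show ?thesis
        by (rule has_field_derivative_transform_within_open[of _ _ _ "{0<..}"]) (use 1 in auto)
    next
      case 2
      have "((\<lambda>t::real. 0) has_real_derivative 2 * max 0 t) (at t)"
        using 2 by auto
      then show ?thesis
        by (rule has_field_derivative_transform_within_open[of _ _ _ "{..<0}"]) (use 2 in auto)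
    next
      case 3
      have "((\<lambda>h::real. (max 0 h)\<^sup>2 / h) \<longlongrightarrow> 0) (at 0)"
      proof (rule Lim_null_comparison)
        have "norm ((max 0 h)\<^sup>2 / h) \<le> \<bar>h\<bar>" for h :: real
          by (cases "h > 0") (auto simp: max_def power2_eq_square)
        then show "\<forall>\<^sub>F h in at 0. norm ((max 0 h)\<^sup>2 / h) \<le> \<bar>h::real\<bar>"
          by simp
        show "((\<lambda>h::real. \<bar>h\<bar>) \<longlongrightarrow> 0) (at 0)"
          by (auto intro!: tendsto_eq_intros)
      qed
      then show ?thesis
        using 3 by (simp add: has_field_derivative_iff)
    qed
  qed
  show ?thesis
    using DERIV_chain'[OF DERIV_diff[OF DERIV_ident DERIV_const] *, of e t] by simp
qed

lemma cutoff_denominator_pos: "e > 0 \<Longrightarrow> (max 0 (t - e))\<^sup>2 + e\<^sup>2 > (0::real)"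
  by (simp add: add_nonneg_pos)

lemma has_real_derivative_cutoff:
  assumes "e > 0"
  shows "(cutoff e has_real_derivative cutoff_slope e t) (at t)"
proof -
  note pos = cutoff_denominator_pos[OF assms, of t]
  have "((\<lambda>t. (max 0 (t - e))\<^sup>2 / ((max 0 (t - e))\<^sup>2 + e\<^sup>2)) has_real_derivative
     ((2 * max 0 (t - e)) * ((max 0 (t - e))\<^sup>2 + e\<^sup>2) - (max 0 (t - e))\<^sup>2 * (2 * max 0 (t - e))) /
     (((max 0 (t - e))\<^sup>2 + e\<^sup>2) * ((max 0 (t - e))\<^sup>2 + e\<^sup>2))) (at t)"
    using pos by (intro DERIV_divide has_real_derivative_max_square DERIV_add[OF has_real_derivative_max_square DERIV_const, simplified]) auto
  moreover have "((2 * max 0 (t - e)) * ((max 0 (t - e))\<^sup>2 + e\<^sup>2) - (max 0 (t - e))\<^sup>2 * (2 * max 0 (t - e))) /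
     (((max 0 (t - e))\<^sup>2 + e\<^sup>2) * ((max 0 (t - e))\<^sup>2 + e\<^sup>2)) = cutoff_slope e t"
    unfolding cutoff_slope_def by (simp add: algebra_simps power2_eq_square)
  moreover have "cutoff e = (\<lambda>t. (max 0 (t - e))\<^sup>2 / ((max 0 (t - e))\<^sup>2 + e\<^sup>2))"
    by (simp add: fun_eq_iff cutoff_def)
  ultimately show ?thesis by simp
qed

lemma cutoff_bounds: "0 \<le> cutoff e t" "cutoff e t \<le> 1"
  unfolding cutoff_def by (auto simp: divide_le_eq_1 add_nonneg_eq_0_iff less_le)

lemma cutoff_eq_0: "t \<le> e \<Longrightarrow> cutoff e t = 0"
  by (simp add: cutoff_def)

lemma cutoff_slope_nonneg: "0 \<le> cutoff_slope e t"
  by (simp add: cutoff_slope_def)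

text \<open>With \<open>r = t - e > 0\<close> the claim is \<open>r e\<^sup>2 (r + e) \<le> (r\<^sup>2 + e\<^sup>2)\<^sup>2\<close>, which follows from
  \<open>2 r e \<le> r\<^sup>2 + e\<^sup>2\<close>. This bound does not depend on \<open>e\<close>, which is what makes dominated convergence
  applicable as the cutoff is removed.\<close>

lemma cutoff_slope_times_distance:
  assumes "e > 0"
  shows "cutoff_slope e t * t \<le> 2"
proof (cases "t \<le> e")
  case False
  define r where "r = t - e"
  have r: "r > 0" "t = r + e" using False by (auto simp: r_def)
  have "2 * r * e \<le> r\<^sup>2 + e\<^sup>2"
    by (rule sum_squares_bound)
  then have "2 * r * e * e\<^sup>2 \<le> (r\<^sup>2 + e\<^sup>2) * e\<^sup>2"
    by (rule mult_right_mono) simp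
  moreover have "(r\<^sup>2 + e\<^sup>2)\<^sup>2 = r\<^sup>2 * r\<^sup>2 + 2 * (r\<^sup>2 * e\<^sup>2) + e\<^sup>2 * e\<^sup>2"
    by (simp add: power2_eq_square algebra_simps)
  moreover have "r\<^sup>2 * r\<^sup>2 \<ge> 0" "e\<^sup>2 * e\<^sup>2 \<ge> 0" "r\<^sup>2 * e\<^sup>2 \<ge> 0"
    by auto
  ultimately have "2 * r * e\<^sup>2 * t \<le> 2 * (r\<^sup>2 + e\<^sup>2)\<^sup>2"
    unfolding r(2) by (simp add: algebra_simps power2_eq_square)
  moreover have "(r\<^sup>2 + e\<^sup>2)\<^sup>2 > 0"
    using assms by (simp add: add_nonneg_pos)
  moreover have "max 0 (t - e) = r"
    using r by simp
  ultimately show ?thesis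
    unfolding cutoff_slope_def by (simp add: divide_le_eq)
qed (simp add: cutoff_slope_def)

lemma tendsto_cutoff:
  assumes "t > 0" "(f \<longlongrightarrow> 0) A"
  shows "((\<lambda>n. cutoff (f n) t) \<longlongrightarrow> 1) A" "((\<lambda>n. cutoff_slope (f n) t) \<longlongrightarrow> 0) A"
proof -
  have "((\<lambda>n. cutoff (f n) t) \<longlongrightarrow> (max 0 (t - 0))\<^sup>2 / ((max 0 (t - 0))\<^sup>2 + 0\<^sup>2)) A"
    unfolding cutoff_def using assms by (intro tendsto_intros) auto
  then show "((\<lambda>n. cutoff (f n) t) \<longlongrightarrow> 1) A"
    using assms by simp
  have "((\<lambda>n. cutoff_slope (f n) t) \<longlongrightarrow> 2 * max 0 (t - 0) * 0\<^sup>2 / ((max 0 (t - 0))\<^sup>2 + 0\<^sup>2)\<^sup>2) A"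
    unfolding cutoff_slope_def using assms by (intro tendsto_intros) auto
  then show "((\<lambda>n. cutoff_slope (f n) t) \<longlongrightarrow> 0) A"
    by simp
qed

text \<open>The polytope is the set where all the affine functions \<open>n i \<bullet> x + c i\<close> are positive.\<close>

definition polytope_cutoff :: "'i set \<Rightarrow> ('i \<Rightarrow> 'a::euclidean_space) \<Rightarrow> ('i \<Rightarrow> real) \<Rightarrow> real \<Rightarrow> 'a \<Rightarrow> real"
  where "polytope_cutoff I n c e x = (\<Prod>i\<in>I. cutoff e (n i \<bullet> x + c i))"

definition polytope_cutoff_gradient :: "'i set \<Rightarrow> ('i \<Rightarrow> 'a::euclidean_space) \<Rightarrow> ('i \<Rightarrow> real) \<Rightarrow> real \<Rightarrow> 'a \<Rightarrow> 'a"
  where "polytope_cutoff_gradient I n c e x =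
    (\<Sum>i\<in>I. (cutoff_slope e (n i \<bullet> x + c i) * (\<Prod>j\<in>I - {i}. cutoff e (n j \<bullet> x + c j))) *\<^sub>R n i)"

lemma gderiv_polytope_cutoff:
  assumes "e > 0"
  shows "GDERIV (polytope_cutoff I n c e) x :> polytope_cutoff_gradient I n c e x"
proof -
  have "((\<lambda>x. cutoff e (n i \<bullet> x + c i)) has_derivative (\<lambda>h. cutoff_slope e (n i \<bullet> x + c i) * (n i \<bullet> h))) (at x)" for i
  proof -
    have 1: "((\<lambda>x. n i \<bullet> x + c i) has_derivative (\<lambda>h. n i \<bullet> h)) (at x)"
      by (auto intro!: derivative_eq_intros)
    have 2: "(cutoff e has_derivative (*) (cutoff_slope e (n i \<bullet> x + c i))) (at (n i \<bullet> x + c i))"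
      using has_real_derivative_cutoff[OF assms] by (simp add: has_field_derivative_def)
    show ?thesis
      using has_derivative_compose[OF 1 2] .
  qed
  then have "((\<lambda>x. \<Prod>i\<in>I. cutoff e (n i \<bullet> x + c i)) has_derivative
     (\<lambda>h. \<Sum>i\<in>I. (cutoff_slope e (n i \<bullet> x + c i) * (n i \<bullet> h)) * (\<Prod>j\<in>I - {i}. cutoff e (n j \<bullet> x + c j)))) (at x)"
    by (intro has_derivative_prod)
  moreover have "(\<lambda>h. \<Sum>i\<in>I. (cutoff_slope e (n i \<bullet> x + c i) * (n i \<bullet> h)) * (\<Prod>j\<in>I - {i}. cutoff e (n j \<bullet> x + c j))) =
      (\<lambda>h. h \<bullet> polytope_cutoff_gradient I n c e x)"
    by (simp add: polytope_cutoff_gradient_def inner_sum_right fun_eq_iff algebra_simps inner_commute)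
  moreover have "polytope_cutoff I n c e = (\<lambda>x. \<Prod>i\<in>I. cutoff e (n i \<bullet> x + c i))"
    by (simp add: fun_eq_iff polytope_cutoff_def)
  ultimately show ?thesis
    by (simp add: gderiv_def)
qed

lemma continuous_on_cutoff: "e > 0 \<Longrightarrow> continuous_on UNIV (cutoff e)"
  using has_real_derivative_cutoff by (meson DERIV_isCont continuous_at_imp_continuous_on)

lemma continuous_on_cutoff_slope: "e > 0 \<Longrightarrow> continuous_on UNIV (cutoff_slope e)"
  unfolding cutoff_slope_def using cutoff_denominator_pos[of e] by (intro continuous_intros) force

lemma continuous_on_polytope_cutoff:
  assumes "e > 0"
  shows "continuous_on UNIV (polytope_cutoff I n c e)" "continuous_on UNIV (polytope_cutoff_gradient I n c e)"
proof -
  have 1: "continuous_on UNIV (\<lambda>x. cutoff e (n i \<bullet> x + c i))" for i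
    by (rule continuous_on_compose2[OF continuous_on_cutoff[OF assms]]) (auto intro!: continuous_intros)
  have 2: "continuous_on UNIV (\<lambda>x. cutoff_slope e (n i \<bullet> x + c i))" for i
    by (rule continuous_on_compose2[OF continuous_on_cutoff_slope[OF assms]]) (auto intro!: continuous_intros)
  show "continuous_on UNIV (polytope_cutoff I n c e)"
    unfolding polytope_cutoff_def by (intro continuous_intros 1)
  show "continuous_on UNIV (polytope_cutoff_gradient I n c e)"
    unfolding polytope_cutoff_gradient_def by (intro continuous_intros 1 2)
qed

lemma polytope_cutoff_bounds: "0 \<le> polytope_cutoff I n c e x" "polytope_cutoff I n c e x \<le> 1"
  unfolding polytope_cutoff_def by (auto intro!: prod_nonneg prod_le_1 cutoff_bounds)

lemma tendsto_polytope_cutoff: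
  assumes "\<And>i. i \<in> I \<Longrightarrow> n i \<bullet> x + c i > 0" "(f \<longlongrightarrow> 0) A"
  shows "((\<lambda>k. polytope_cutoff I n c (f k) x) \<longlongrightarrow> 1) A"
    "((\<lambda>k. polytope_cutoff_gradient I n c (f k) x) \<longlongrightarrow> 0) A"
proof -
  have "((\<lambda>k. polytope_cutoff I n c (f k) x) \<longlongrightarrow> (\<Prod>i\<in>I. 1)) A"
    unfolding polytope_cutoff_def using assms by (intro tendsto_prod tendsto_cutoff) auto
  then show "((\<lambda>k. polytope_cutoff I n c (f k) x) \<longlongrightarrow> 1) A"
    by simp
  have "((\<lambda>k. polytope_cutoff_gradient I n c (f k) x) \<longlongrightarrow> (\<Sum>i\<in>I. (0 * (\<Prod>j\<in>I - {i}. 1)) *\<^sub>R n i)) A"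
    unfolding polytope_cutoff_gradient_def using assms
    by (intro tendsto_sum tendsto_scaleR tendsto_mult tendsto_prod tendsto_const tendsto_cutoff) auto
  then show "((\<lambda>k. polytope_cutoff_gradient I n c (f k) x) \<longlongrightarrow> 0) A"
    by simp
qed

lemma polytope_cutoff_support:
  assumes "finite I" "e > 0" "polytope_cutoff I n c e x \<noteq> 0" "i \<in> I"
  shows "e \<le> n i \<bullet> x + c i"
proof (rule ccontr)
  assume "\<not> e \<le> n i \<bullet> x + c i"
  then have "cutoff e (n i \<bullet> x + c i) = 0"
    by (simp add: cutoff_eq_0)
  then have "polytope_cutoff I n c e x = 0"
    unfolding polytope_cutoff_def using assms(1,4) by (meson prod_zero)
  with assms(3) show False ..
qed

text \<open>The slope of each factor is of the order of the inverse distance to the corresponding side, and the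
  component of \<open>y\<close> in the direction \<open>n i\<close> compensates exactly for it.\<close>

lemma tangential_field_dot_cutoff_gradient:
  assumes "e > 0" and tan: "\<And>i. i \<in> I \<Longrightarrow> \<bar>y \<bullet> n i\<bar> \<le> L * (n i \<bullet> x + c i)" and "L \<ge> 0"
  shows "\<bar>y \<bullet> polytope_cutoff_gradient I n c e x\<bar> \<le> 2 * L * card I"
proof -
  have "\<bar>y \<bullet> polytope_cutoff_gradient I n c e x\<bar> \<le>
    (\<Sum>i\<in>I. \<bar>(cutoff_slope e (n i \<bullet> x + c i) * (\<Prod>j\<in>I - {i}. cutoff e (n j \<bullet> x + c j))) * (y \<bullet> n i)\<bar>)"
    unfolding polytope_cutoff_gradient_def inner_sum_right inner_scaleR_right by (rule sum_abs)
  also have "\<dots> \<le> (\<Sum>i\<in>I. 2 * L)"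
  proof (rule sum_mono)
    fix i assume i: "i \<in> I"
    let ?s = "n i \<bullet> x + c i" and ?p = "\<Prod>j\<in>I - {i}. cutoff e (n j \<bullet> x + c j)"
    have p: "0 \<le> ?p" "?p \<le> 1"
      by (auto intro!: prod_nonneg prod_le_1 cutoff_bounds)
    have "\<bar>(cutoff_slope e ?s * ?p) * (y \<bullet> n i)\<bar> = ?p * (cutoff_slope e ?s * \<bar>y \<bullet> n i\<bar>)"
      using p cutoff_slope_nonneg[of e ?s] by (simp add: abs_mult)
    also have "\<dots> \<le> 1 * (cutoff_slope e ?s * (L * ?s))"
      using p tan[OF i] cutoff_slope_nonneg[of e ?s] by (intro mult_mono mult_left_mono mult_nonneg_nonneg) auto
    also have "\<dots> \<le> 2 * L"
      using mult_left_mono[OF cutoff_slope_times_distance[OF assms(1), of ?s] \<open>L \<ge> 0\<close>] by (simp add: algebra_simps)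
    finally show "\<bar>(cutoff_slope e ?s * ?p) * (y \<bullet> n i)\<bar> \<le> 2 * L" .
  qed
  finally show ?thesis by (simp add: mult.commute)
qed

section \<open>Integration by parts for tangential fields\<close>

lemma open_polytope:
  fixes n :: "'i \<Rightarrow> 'a::euclidean_space"
  assumes "finite I"
  shows "open {x. \<forall>i\<in>I. n i \<bullet> x + c i > 0}"
proof -
  have "open {x. n i \<bullet> x + c i > 0}" for i
    by (intro open_Collect_less continuous_intros)
  then have "open (\<Inter>i\<in>I. {x. n i \<bullet> x + c i > 0})"
    using assms by blast
  moreover have "(\<Inter>i\<in>I. {x. n i \<bullet> x + c i > 0}) = {x. \<forall>i\<in>I. n i \<bullet> x + c i > 0}"
    by blast
  ultimately show ?thesis by simp
qed

lemma test_function_polytope_cutoff: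
  fixes n :: "'i \<Rightarrow> 'a::euclidean_space"
  assumes I: "finite I" and e: "e > 0"
    and \<Omega>: "\<Omega> = {x. \<forall>i\<in>I. n i \<bullet> x + c i > 0}" "bounded \<Omega>"
    and f: "\<And>x. GDERIV f x :> f' x" "continuous_on UNIV f'"
  shows "test_function \<Omega> (\<lambda>x. polytope_cutoff I n c e x * f x)
     (\<lambda>x. polytope_cutoff I n c e x *\<^sub>R f' x + f x *\<^sub>R polytope_cutoff_gradient I n c e x)"
proof -
  let ?S = "{x. \<forall>i\<in>I. e \<le> n i \<bullet> x + c i}" and ?D = "{x. polytope_cutoff I n c e x * f x \<noteq> 0}"
  have cf: "continuous_on UNIV f"
    using f(1) by (auto simp: gderiv_def continuous_on_eq_continuous_at dest: has_derivative_continuous)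
  have "closed {x. e \<le> n i \<bullet> x + c i}" for i
    by (intro closed_Collect_le continuous_intros)
  then have "closed (\<Inter>i\<in>I. {x. e \<le> n i \<bullet> x + c i})"
    by blast
  moreover have "(\<Inter>i\<in>I. {x. e \<le> n i \<bullet> x + c i}) = ?S"
    by blast
  moreover have "?D \<subseteq> ?S"
    using polytope_cutoff_support[OF I e] by auto
  ultimately have 1: "closure ?D \<subseteq> ?S"
    using closure_minimal[of ?D ?S] by argo
  have 2: "?S \<subseteq> \<Omega>"
    using e unfolding \<Omega>(1) by force
  have "bounded (closure ?D)"
    by (rule bounded_subset[OF \<Omega>(2) order_trans[OF 1 2]])
  then have "compact (closure ?D)"
    by (simp only: compact_eq_bounded_closed closed_closure simp_thms)
  moreover have "closure ?D \<subseteq> \<Omega>"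
    by (rule order_trans[OF 1 2])
  moreover have "continuous_on UNIV (\<lambda>x. polytope_cutoff I n c e x *\<^sub>R f' x + f x *\<^sub>R polytope_cutoff_gradient I n c e x)"
    by (intro continuous_intros continuous_on_polytope_cutoff e f(2) cf)
  ultimately show ?thesis
    unfolding test_function_def using GDERIV_mult[OF gderiv_polytope_cutoff[OF e] f(1)] by blast
qed

lemma set_integral_inner_left:
  fixes f :: "'a \<Rightarrow> 'b::euclidean_space"
  assumes "set_integrable M A f"
  shows "(LINT x:A|M. f x) \<bullet> b = (LINT x:A|M. f x \<bullet> b)"
  using assms integral_inner_left[of b M "\<lambda>x. indicator A x *\<^sub>R f x"]
  by (simp add: set_lebesgue_integral_def set_integrable_def)

text \<open>The components of the field, multiplied by the cutoff, are admissible test functions for the weak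
  gradient of \<open>w\<close>. Taking the component of each identity in its own basis direction and adding up turns
  the gradients into a divergence.\<close>

lemma integration_by_parts_cutoff:
  fixes n :: "'i \<Rightarrow> 'a::euclidean_space"
  assumes I: "finite I" and e: "e > 0"
    and \<Omega>: "\<Omega> = {x. \<forall>i\<in>I. n i \<bullet> x + c i > 0}" "bounded \<Omega>"
    and F: "\<And>b x. b \<in> Basis \<Longrightarrow> GDERIV (\<lambda>x. F x \<bullet> b) x :> F' b x" "\<And>b. b \<in> Basis \<Longrightarrow> continuous_on UNIV (F' b)"
    and w: "H1 \<Omega> w W"
  shows "(LINT x:\<Omega>|lborel. w x * (polytope_cutoff I n c e x * (\<Sum>b\<in>Basis. F' b x \<bullet> b)
      + F x \<bullet> polytope_cutoff_gradient I n c e x)) =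
    - (LINT x:\<Omega>|lborel. polytope_cutoff I n c e x * (F x \<bullet> W x))"
proof -
  let ?\<chi> = "polytope_cutoff I n c e" and ?\<chi>' = "polytope_cutoff_gradient I n c e"
  have meas: "\<Omega> \<in> sets borel"
    unfolding \<Omega>(1) by (intro borel_open open_polytope I)
  define g where "g b x = ?\<chi> x *\<^sub>R F' b x + (F x \<bullet> b) *\<^sub>R ?\<chi>' x" for b x
  have w2: "square_integrable_on w \<Omega>" "square_integrable_on W \<Omega>"
    using w by (auto simp: H1_def)
  {
    fix b :: 'a assume b: "b \<in> Basis"
    have t: "test_function \<Omega> (\<lambda>x. ?\<chi> x * (F x \<bullet> b)) (g b)"
      unfolding g_def by (rule test_function_polytope_cutoff[OF I e \<Omega> F(1)[OF b] F(2)[OF b]])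
    note si = test_function_square_integrable[OF \<Omega>(2) meas t]
    have i: "set_integrable lborel \<Omega> (\<lambda>x. w x *\<^sub>R g b x)"
      "set_integrable lborel \<Omega> (\<lambda>x. (?\<chi> x * (F x \<bullet> b)) *\<^sub>R W x)"
      using w2 si by (auto intro: square_integrable_scaleR)
    have "(LINT x:\<Omega>|lborel. w x *\<^sub>R g b x) = - (LINT x:\<Omega>|lborel. (?\<chi> x * (F x \<bullet> b)) *\<^sub>R W x)"
      using w t by (simp add: H1_def weak_gradient_def)
    then have eq: "(LINT x:\<Omega>|lborel. (w x *\<^sub>R g b x) \<bullet> b) = - (LINT x:\<Omega>|lborel. ((?\<chi> x * (F x \<bullet> b)) *\<^sub>R W x) \<bullet> b)"
      unfolding set_integral_inner_left[OF i(1), symmetric] set_integral_inner_left[OF i(2), symmetric]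
      by simp
    have i': "set_integrable lborel \<Omega> (\<lambda>x. (w x *\<^sub>R g b x) \<bullet> b)"
      "set_integrable lborel \<Omega> (\<lambda>x. ((?\<chi> x * (F x \<bullet> b)) *\<^sub>R W x) \<bullet> b)"
      unfolding set_integrable_def
      using integrable_inner_left[of b, OF i(1)[unfolded set_integrable_def]]
        integrable_inner_left[of b, OF i(2)[unfolded set_integrable_def]]
      by (simp_all add: mult.assoc)
    note eq i'
  } note parts = this
  have sum: "(LINT x:\<Omega>|lborel. (\<Sum>b\<in>Basis. h b x)) = (\<Sum>b\<in>Basis. LINT x:\<Omega>|lborel. h b x)"
    if "\<And>b. b \<in> Basis \<Longrightarrow> set_integrable lborel \<Omega> (h b)" for h :: "'a \<Rightarrow> 'a \<Rightarrow> real"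
    using that unfolding set_lebesgue_integral_def set_integrable_def scaleR_sum_right
    by (rule Bochner_Integration.integral_sum)
  have "(LINT x:\<Omega>|lborel. (\<Sum>b\<in>Basis. (w x *\<^sub>R g b x) \<bullet> b)) =
      (\<Sum>b\<in>Basis. LINT x:\<Omega>|lborel. (w x *\<^sub>R g b x) \<bullet> b)"
    by (rule sum[of "\<lambda>b x. (w x *\<^sub>R g b x) \<bullet> b"]) (rule parts(2))
  also have "\<dots> = (\<Sum>b\<in>Basis. - (LINT x:\<Omega>|lborel. ((?\<chi> x * (F x \<bullet> b)) *\<^sub>R W x) \<bullet> b))"
    by (rule sum.cong) (simp_all only: parts(1))
  also have "\<dots> = - (LINT x:\<Omega>|lborel. (\<Sum>b\<in>Basis. ((?\<chi> x * (F x \<bullet> b)) *\<^sub>R W x) \<bullet> b))"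
    unfolding sum_negf
    by (subst sum[of "\<lambda>b x. ((?\<chi> x * (F x \<bullet> b)) *\<^sub>R W x) \<bullet> b"]) (simp_all only: parts(3))
  finally have "(LINT x:\<Omega>|lborel. (\<Sum>b\<in>Basis. (w x *\<^sub>R g b x) \<bullet> b)) =
     - (LINT x:\<Omega>|lborel. (\<Sum>b\<in>Basis. ((?\<chi> x * (F x \<bullet> b)) *\<^sub>R W x) \<bullet> b))" .
  moreover have "(\<Sum>b\<in>Basis. (w x *\<^sub>R g b x) \<bullet> b) = w x * (?\<chi> x * (\<Sum>b\<in>Basis. F' b x \<bullet> b) + F x \<bullet> ?\<chi>' x)" for x
    unfolding euclidean_inner[of "F x" "?\<chi>' x"]
    by (simp add: g_def inner_add_left sum.distrib sum_distrib_left algebra_simps)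
  moreover have "(\<Sum>b\<in>Basis. ((?\<chi> x * (F x \<bullet> b)) *\<^sub>R W x) \<bullet> b) = ?\<chi> x * (F x \<bullet> W x)" for x
    unfolding euclidean_inner[of "F x" "W x"] by (simp add: sum_distrib_left mult.assoc)
  ultimately show ?thesis by simp
qed

text \<open>Let the cutoff parameter tend to 0. The term containing the gradient of the cutoff is bounded by a
  constant times \<open>\<bar>w\<bar>\<close> and tends to 0 pointwise, so it disappears in the limit.\<close>

lemma integration_by_parts_tangential_field:
  fixes n :: "'i \<Rightarrow> 'a::euclidean_space"
  assumes I: "finite I"
    and \<Omega>: "\<Omega> = {x. \<forall>i\<in>I. n i \<bullet> x + c i > 0}" "bounded \<Omega>"
    and F: "continuous_on UNIV F" "\<And>b x. b \<in> Basis \<Longrightarrow> GDERIV (\<lambda>x. F x \<bullet> b) x :> F' b x" "\<And>b. b \<in> Basis \<Longrightarrow> continuous_on UNIV (F' b)"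
    and tan: "\<And>i x. x \<in> \<Omega> \<Longrightarrow> i \<in> I \<Longrightarrow> \<bar>F x \<bullet> n i\<bar> \<le> L * (n i \<bullet> x + c i)" "L \<ge> 0"
    and w: "H1 \<Omega> w W"
  shows "(LINT x:\<Omega>|lborel. F x \<bullet> W x) = - (LINT x:\<Omega>|lborel. (\<Sum>b\<in>Basis. F' b x \<bullet> b) * w x)"
proof -
  define e :: "nat \<Rightarrow> real" where "e k = 1 / real (Suc k)" for k
  have e: "e k > 0" for k
    by (simp add: e_def)
  have e0: "e \<longlonglongrightarrow> 0"
    unfolding e_def using LIMSEQ_inverse_real_of_nat by (simp add: inverse_eq_divide)
  let ?\<chi> = "\<lambda>k. polytope_cutoff I n c (e k)" and ?\<chi>' = "\<lambda>k. polytope_cutoff_gradient I n c (e k)"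
  define d where "d x = (\<Sum>b\<in>Basis. F' b x \<bullet> b)" for x
  have cd: "continuous_on UNIV d"
    unfolding d_def using F(3) by (intro continuous_intros) auto
  have meas: "\<Omega> \<in> sets borel"
    unfolding \<Omega>(1) by (intro borel_open open_polytope I)
  have w2: "square_integrable_on w \<Omega>" "square_integrable_on W \<Omega>"
    using w by (auto simp: H1_def)
  note sq = square_integrable_on_continuous[OF \<Omega>(2) meas]
  have iw: "set_integrable lborel \<Omega> w"
    by (rule square_integrable_on_imp_integrable[OF \<Omega>(2) meas w2(1)])
  have iwd: "set_integrable lborel \<Omega> (\<lambda>x. w x * d x)"
    by (rule square_integrable_product[OF w2(1) sq[OF cd]])
  have iFW: "set_integrable lborel \<Omega> (\<lambda>x. F x \<bullet> W x)"
    by (rule square_integrable_inner[OF sq[OF F(1)] w2(2)])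
  have pos: "n i \<bullet> x + c i > 0" if "x \<in> \<Omega>" "i \<in> I" for x i
    using that \<Omega>(1) by blast
  have "(\<lambda>k. LINT x|lborel. indicator \<Omega> x *\<^sub>R (w x * (?\<chi> k x * d x + F x \<bullet> ?\<chi>' k x)))
      \<longlonglongrightarrow> (LINT x|lborel. indicator \<Omega> x *\<^sub>R (w x * d x))"
  proof (rule integral_dominated_convergence)
    show "(\<lambda>x. indicator \<Omega> x *\<^sub>R (w x * d x)) \<in> borel_measurable lborel"
      using iwd unfolding set_integrable_def by (rule borel_measurable_integrable)
    show "(\<lambda>x. indicator \<Omega> x *\<^sub>R (w x * (?\<chi> k x * d x + F x \<bullet> ?\<chi>' k x))) \<in> borel_measurable lborel" for k
    proof (rule borel_measurable_integrable)
      show "integrable lborel (\<lambda>x. indicator \<Omega> x *\<^sub>R (w x * (?\<chi> k x * d x + F x \<bullet> ?\<chi>' k x)))"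
        unfolding set_integrable_def[symmetric]
        by (rule square_integrable_product[OF w2(1) sq])
            (intro continuous_intros cd F(1) continuous_on_polytope_cutoff e)
    qed
    show "integrable lborel (\<lambda>x. norm (indicator \<Omega> x *\<^sub>R (w x * d x)) + (2 * L * card I) * norm (indicator \<Omega> x *\<^sub>R w x))"
      using iw iwd unfolding set_integrable_def
      by (intro Bochner_Integration.integrable_add integrable_mult_right integrable_norm)
    show "AE x in lborel. (\<lambda>k. indicator \<Omega> x *\<^sub>R (w x * (?\<chi> k x * d x + F x \<bullet> ?\<chi>' k x))) \<longlonglongrightarrow> indicator \<Omega> x *\<^sub>R (w x * d x)"
    proof (intro AE_I2)
      fix x
      show "(\<lambda>k. indicator \<Omega> x *\<^sub>R (w x * (?\<chi> k x * d x + F x \<bullet> ?\<chi>' k x))) \<longlonglongrightarrow> indicator \<Omega> x *\<^sub>R (w x * d x)"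
      proof (cases "x \<in> \<Omega>")
        case True
        have "(\<lambda>k. indicator \<Omega> x *\<^sub>R (w x * (?\<chi> k x * d x + F x \<bullet> ?\<chi>' k x))) \<longlonglongrightarrow> indicator \<Omega> x *\<^sub>R (w x * (1 * d x + F x \<bullet> 0))"
          by (intro tendsto_intros tendsto_polytope_cutoff e0 pos[OF True])
        then show ?thesis by simp
      qed simp
    qed
    show "AE x in lborel. norm (indicator \<Omega> x *\<^sub>R (w x * (?\<chi> k x * d x + F x \<bullet> ?\<chi>' k x))) \<le>
      norm (indicator \<Omega> x *\<^sub>R (w x * d x)) + (2 * L * card I) * norm (indicator \<Omega> x *\<^sub>R w x)" for k
    proof (intro AE_I2)
      fix x
      show "norm (indicator \<Omega> x *\<^sub>R (w x * (?\<chi> k x * d x + F x \<bullet> ?\<chi>' k x))) \<le>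
        norm (indicator \<Omega> x *\<^sub>R (w x * d x)) + (2 * L * card I) * norm (indicator \<Omega> x *\<^sub>R w x)"
      proof (cases "x \<in> \<Omega>")
        case True
        have "\<bar>?\<chi> k x * d x\<bar> \<le> \<bar>d x\<bar>"
          using polytope_cutoff_bounds[of I n c "e k" x] by (simp add: abs_mult mult_left_le_one_le)
        moreover have "\<bar>F x \<bullet> ?\<chi>' k x\<bar> \<le> 2 * L * card I"
          using tangential_field_dot_cutoff_gradient[OF e tan(1)[OF True] tan(2)] .
        ultimately have "\<bar>?\<chi> k x * d x + F x \<bullet> ?\<chi>' k x\<bar> \<le> \<bar>d x\<bar> + 2 * L * card I"
          by linarith
        then have "\<bar>w x\<bar> * \<bar>?\<chi> k x * d x + F x \<bullet> ?\<chi>' k x\<bar> \<le> \<bar>w x\<bar> * (\<bar>d x\<bar> + 2 * L * card I)"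
          by (rule mult_left_mono) simp
        moreover have "norm (indicator \<Omega> x *\<^sub>R (w x * (?\<chi> k x * d x + F x \<bullet> ?\<chi>' k x))) =
            \<bar>w x\<bar> * \<bar>?\<chi> k x * d x + F x \<bullet> ?\<chi>' k x\<bar>"
          using True by (simp only: indicator_simps scaleR_one real_norm_def abs_mult)
        moreover have "norm (indicator \<Omega> x *\<^sub>R (w x * d x)) + (2 * L * card I) * norm (indicator \<Omega> x *\<^sub>R w x) =
            \<bar>w x\<bar> * (\<bar>d x\<bar> + 2 * L * card I)"
          using True by (simp add: abs_mult algebra_simps)
        ultimately show ?thesis
          by linarith
      qed simp
    qed
  qed
  moreover have "(\<lambda>k. LINT x|lborel. indicator \<Omega> x *\<^sub>R (?\<chi> k x * (F x \<bullet> W x)))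
      \<longlonglongrightarrow> (LINT x|lborel. indicator \<Omega> x *\<^sub>R (F x \<bullet> W x))"
  proof (rule integral_dominated_convergence)
    show mFW: "(\<lambda>x. indicator \<Omega> x *\<^sub>R (F x \<bullet> W x)) \<in> borel_measurable lborel"
      using iFW unfolding set_integrable_def by (rule borel_measurable_integrable)
    show "(\<lambda>x. indicator \<Omega> x *\<^sub>R (?\<chi> k x * (F x \<bullet> W x))) \<in> borel_measurable lborel" for k
    proof -
      have "?\<chi> k \<in> borel_measurable lborel"
        using borel_measurable_continuous_onI[OF continuous_on_polytope_cutoff(1)[OF e]] by simp
      from borel_measurable_times[OF this mFW] show ?thesis
        by (simp add: mult.left_commute)
    qed
    show "integrable lborel (\<lambda>x. norm (indicator \<Omega> x *\<^sub>R (F x \<bullet> W x)))"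
      using iFW unfolding set_integrable_def by (rule integrable_norm)
    show "AE x in lborel. (\<lambda>k. indicator \<Omega> x *\<^sub>R (?\<chi> k x * (F x \<bullet> W x))) \<longlonglongrightarrow> indicator \<Omega> x *\<^sub>R (F x \<bullet> W x)"
    proof (intro AE_I2)
      fix x
      show "(\<lambda>k. indicator \<Omega> x *\<^sub>R (?\<chi> k x * (F x \<bullet> W x))) \<longlonglongrightarrow> indicator \<Omega> x *\<^sub>R (F x \<bullet> W x)"
      proof (cases "x \<in> \<Omega>")
        case True
        have "(\<lambda>k. indicator \<Omega> x *\<^sub>R (?\<chi> k x * (F x \<bullet> W x))) \<longlonglongrightarrow> indicator \<Omega> x *\<^sub>R (1 * (F x \<bullet> W x))"
          by (intro tendsto_intros tendsto_polytope_cutoff e0 pos[OF True])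
        then show ?thesis by simp
      qed simp
    qed
    show "AE x in lborel. norm (indicator \<Omega> x *\<^sub>R (?\<chi> k x * (F x \<bullet> W x))) \<le> norm (indicator \<Omega> x *\<^sub>R (F x \<bullet> W x))" for k
      using polytope_cutoff_bounds[of I n c "e k"] by (intro AE_I2) (simp add: abs_mult indicator_def mult_left_le_one_le)
  qed
  moreover have "(LINT x|lborel. indicator \<Omega> x *\<^sub>R (w x * (?\<chi> k x * d x + F x \<bullet> ?\<chi>' k x))) =
      - (LINT x|lborel. indicator \<Omega> x *\<^sub>R (?\<chi> k x * (F x \<bullet> W x)))" for k
    using integration_by_parts_cutoff[OF I e \<Omega> F(2,3) w, of k]
    unfolding set_lebesgue_integral_def d_def by simp
  ultimately have "(LINT x|lborel. indicator \<Omega> x *\<^sub>R (w x * d x)) = - (LINT x|lborel. indicator \<Omega> x *\<^sub>R (F x \<bullet> W x))"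
    by (simp only:) (rule LIMSEQ_unique, assumption, erule tendsto_minus)
  then show ?thesis
    unfolding set_lebesgue_integral_def d_def[symmetric] by (simp add: mult.commute[of "w _"])
qed

text \<open>The classical Neumann condition appears as a linear bound on the normal component of the gradient
  inside the domain: for a \<open>C\<^sup>1\<close> gradient this is what the vanishing of the normal derivative on the
  sides amounts to, and it is the form in which the integration by parts uses it.\<close>

lemma neumann_laplacian_of_tangential_gradient:
  fixes n :: "'i \<Rightarrow> 'a::euclidean_space"
  assumes I: "finite I"
    and \<Omega>: "\<Omega> = {x. \<forall>i\<in>I. n i \<bullet> x + c i > 0}" "bounded \<Omega>"
    and f: "\<And>x. GDERIV f x :> F x"
    and F: "continuous_on UNIV F" "\<And>b x. b \<in> Basis \<Longrightarrow> GDERIV (\<lambda>x. F x \<bullet> b) x :> F' b x" "\<And>b. b \<in> Basis \<Longrightarrow> continuous_on UNIV (F' b)"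
    and tan: "\<And>i x. x \<in> \<Omega> \<Longrightarrow> i \<in> I \<Longrightarrow> \<bar>F x \<bullet> n i\<bar> \<le> L * (n i \<bullet> x + c i)" "L \<ge> 0"
    and u: "\<And>x. x \<in> \<Omega> \<Longrightarrow> u x = f x" and h: "\<And>x. x \<in> \<Omega> \<Longrightarrow> h x = - (\<Sum>b\<in>Basis. F' b x \<bullet> b)"
  shows "neumann_laplacian \<Omega> u h"
proof -
  have meas: "\<Omega> \<in> sets borel"
    unfolding \<Omega>(1) by (intro borel_open open_polytope I)
  have cf: "continuous_on UNIV f"
    using f by (auto simp: gderiv_def continuous_on_eq_continuous_at dest: has_derivative_continuous)
  note sq = square_integrable_on_continuous[OF \<Omega>(2) meas]
  have "square_integrable_on u \<Omega>"
    by (rule square_integrable_on_cong[OF _ sq[OF cf]]) (simp add: u)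
  moreover have "weak_gradient \<Omega> u F"
  proof -
    have "(LINT x:\<Omega>|lborel. u x *\<^sub>R g x) = (LINT x:\<Omega>|lborel. f x *\<^sub>R g x)" for g :: "'a \<Rightarrow> 'a"
      using meas by (intro set_lebesgue_integral_cong) (auto simp: u)
    then show ?thesis
      using gderiv_imp_weak_gradient[OF \<Omega>(2) meas f F(1)] by (simp add: weak_gradient_def)
  qed
  ultimately have H: "H1 \<Omega> u F"
    using sq[OF F(1)] by (simp add: H1_def)
  have "square_integrable_on h \<Omega>"
  proof (rule square_integrable_on_cong[OF h[symmetric] sq])
    show "continuous_on UNIV (\<lambda>x. - (\<Sum>b\<in>Basis. F' b x \<bullet> b))"
      using F(3) by (intro continuous_intros) auto
  qed
  moreover have "(LINT x:\<Omega>|lborel. F x \<bullet> W x) = (LINT x:\<Omega>|lborel. h x * w x)" if "H1 \<Omega> w W" for w W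
  proof -
    have "(LINT x:\<Omega>|lborel. h x * w x) = (LINT x:\<Omega>|lborel. - ((\<Sum>b\<in>Basis. F' b x \<bullet> b) * w x))"
      using meas by (intro set_lebesgue_integral_cong) (auto simp: h)
    also have "\<dots> = - (LINT x:\<Omega>|lborel. (\<Sum>b\<in>Basis. F' b x \<bullet> b) * w x)"
      by (simp add: set_lebesgue_integral_def)
    finally show ?thesis
      using integration_by_parts_tangential_field[OF I \<Omega> F tan that] by simp
  qed
  ultimately show ?thesis
    unfolding neumann_laplacian_def using H by blast
qed

section \<open>The triangle and its sides\<close>

lemma sqrt3_square [simp]: "sqrt 3 * sqrt 3 = 3" "sqrt 3 * (sqrt 3 * x) = 3 * x" "sqrt 3 * (x * sqrt 3) = 3 * x"
  by (simp_all add: mult.assoc[symmetric])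

text \<open>Inward normals and offsets, scaled such that the three affine functions \<open>n \<bullet> p + c\<close> are the
  barycentric coordinates of \<open>p\<close>.\<close>

definition triangle_sides :: "((real \<times> real) \<times> real) set"
  where "triangle_sides = {((0, 2 * sqrt 3 / 3), 0), ((1, - sqrt 3 / 3), 0), ((-1, - sqrt 3 / 3), 1)}"

lemma finite_triangle_sides: "finite triangle_sides"
  by (simp add: triangle_sides_def)

lemma sides_pos_iff:
  "(\<forall>i\<in>triangle_sides. fst i \<bullet> p + snd i > 0) \<longleftrightarrow>
    0 < snd p \<and> snd p < sqrt 3 * fst p \<and> sqrt 3 * fst p + snd p < sqrt 3"
proof -
  have "3 * fst p - sqrt 3 * snd p = sqrt 3 * (sqrt 3 * fst p - snd p)"
    "3 - (3 * fst p + sqrt 3 * snd p) = sqrt 3 * (sqrt 3 - (sqrt 3 * fst p + snd p))"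
    by (simp_all add: algebra_simps)
  then have "3 * fst p - sqrt 3 * snd p > 0 \<longleftrightarrow> sqrt 3 * fst p - snd p > 0"
    "3 - (3 * fst p + sqrt 3 * snd p) > 0 \<longleftrightarrow> sqrt 3 - (sqrt 3 * fst p + snd p) > 0"
    by (simp_all only: zero_less_mult_iff) auto
  then show ?thesis
    by (cases p) (auto simp: triangle_sides_def field_simps zero_less_mult_iff)
qed

lemma equilateral_triangle_eq_sides:
  "equilateral_triangle = {p. \<forall>i\<in>triangle_sides. fst i \<bullet> p + snd i > 0}"
proof -
  have nc: "\<not> collinear {(0, 0), (1, 0), (1/2, sqrt 3 / 2) :: real \<times> real}"
  proof
    assume "collinear {(0, 0), (1, 0), (1/2, sqrt 3 / 2) :: real \<times> real}"
    then obtain u :: "real \<times> real" where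
      u: "\<forall>x\<in>{(0, 0), (1, 0), (1/2, sqrt 3 / 2)}. \<forall>y\<in>{(0, 0), (1, 0), (1/2, sqrt 3 / 2)}. \<exists>c. x - y = c *\<^sub>R u"
      unfolding collinear_def by blast
    from u obtain c where c: "(1, 0) - (0, 0) = c *\<^sub>R u" by blast
    from u obtain d where d: "(1/2, sqrt 3 / 2) - (0, 0) = d *\<^sub>R u" by blast
    from c d show False
      by (cases u) auto
  qed
  have "interior (convex hull {(0, 0), (1, 0), (1/2, sqrt 3 / 2)}) =
      {v :: real \<times> real. \<exists>x y z. 0 < x \<and> 0 < y \<and> 0 < z \<and> x + y + z = 1 \<and>
        x *\<^sub>R (0, 0) + y *\<^sub>R (1, 0) + z *\<^sub>R (1/2, sqrt 3 / 2) = v}"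
    by (rule interior_convex_hull_3_minimal[OF nc]) simp
  also have "\<dots> = {p. \<forall>i\<in>triangle_sides. fst i \<bullet> p + snd i > 0}"
  proof (intro set_eqI iffI)
    fix v :: "real \<times> real"
    assume "v \<in> {v. \<exists>x y z. 0 < x \<and> 0 < y \<and> 0 < z \<and> x + y + z = 1 \<and>
        x *\<^sub>R (0, 0) + y *\<^sub>R (1, 0) + z *\<^sub>R (1/2, sqrt 3 / 2) = v}"
    then obtain x y z where h: "0 < x" "0 < y" "0 < z" "x + y + z = 1" "v = (y + z / 2, z * sqrt 3 / 2)"
      by auto
    show "v \<in> {p. \<forall>i\<in>triangle_sides. fst i \<bullet> p + snd i > 0}"
      using h by (auto simp: triangle_sides_def)
  next
    fix v :: "real \<times> real"
    assume "v \<in> {p. \<forall>i\<in>triangle_sides. fst i \<bullet> p + snd i > 0}"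
    then have h: "fst v - sqrt 3 / 3 * snd v > 0" "2 * sqrt 3 / 3 * snd v > 0"
        "1 - fst v - sqrt 3 / 3 * snd v > 0"
      by (cases v; auto simp: triangle_sides_def)+
    have "(1 - fst v - sqrt 3 / 3 * snd v) *\<^sub>R (0, 0) + (fst v - sqrt 3 / 3 * snd v) *\<^sub>R (1, 0)
        + (2 * sqrt 3 / 3 * snd v) *\<^sub>R (1/2, sqrt 3 / 2) = v"
      by (cases v) simp
    moreover have "(1 - fst v - sqrt 3 / 3 * snd v) + (fst v - sqrt 3 / 3 * snd v) + 2 * sqrt 3 / 3 * snd v = 1"
      by simp
    ultimately show "v \<in> {v. \<exists>x y z. 0 < x \<and> 0 < y \<and> 0 < z \<and> x + y + z = 1 \<and>
        x *\<^sub>R (0, 0) + y *\<^sub>R (1, 0) + z *\<^sub>R (1/2, sqrt 3 / 2) = v}"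
      using h by blast
  qed
  finally show ?thesis
    unfolding equilateral_triangle_def .
qed

lemma in_triangle_iff:
  "p \<in> equilateral_triangle \<longleftrightarrow> 0 < snd p \<and> snd p < sqrt 3 * fst p \<and> sqrt 3 * fst p + snd p < sqrt 3"
  unfolding equilateral_triangle_eq_sides mem_Collect_eq by (rule sides_pos_iff)

lemma bounded_triangle: "bounded equilateral_triangle"
  unfolding equilateral_triangle_def
  by (rule bounded_interior) (simp add: bounded_convex_hull)

lemma open_triangle: "open equilateral_triangle"
  unfolding equilateral_triangle_def by simp

lemma triangle_borel: "equilateral_triangle \<in> sets borel"
  by (intro borel_open open_triangle)

section \<open>Symmetric sums of plane waves\<close>

text \<open>The amplitudes \<open>A\<close> and the common phase \<open>d\<close> make the class closed under differentiation: a partial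
  derivative multiplies the amplitudes by components of the frequencies and shifts the phase by
  \<open>\<pi>/2\<close>.\<close>

definition plane_wave_sum :: "'a::real_inner list \<Rightarrow> (nat \<Rightarrow> real) \<Rightarrow> real \<Rightarrow> 'a \<Rightarrow> real"
  where "plane_wave_sum vs A d p = (\<Sum>i<length vs. A i * cos (vs ! i \<bullet> p + d))"

definition plane_wave_gradient :: "'a::real_inner list \<Rightarrow> (nat \<Rightarrow> real) \<Rightarrow> real \<Rightarrow> 'a \<Rightarrow> 'a"
  where "plane_wave_gradient vs A d p = (\<Sum>i<length vs. (- A i * sin (vs ! i \<bullet> p + d)) *\<^sub>R (vs ! i))"

lemma gderiv_plane_wave_sum: "GDERIV (plane_wave_sum vs A d) p :> plane_wave_gradient vs A d p"
proof -
  have "((\<lambda>p. A i * cos (vs ! i \<bullet> p + d)) has_derivative (\<lambda>h. - A i * sin (vs ! i \<bullet> p + d) * (vs ! i \<bullet> h))) (at p)" for i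
    by (auto intro!: derivative_eq_intros simp: algebra_simps)
  then have "((\<lambda>p. \<Sum>i<length vs. A i * cos (vs ! i \<bullet> p + d)) has_derivative
      (\<lambda>h. \<Sum>i<length vs. - A i * sin (vs ! i \<bullet> p + d) * (vs ! i \<bullet> h))) (at p)"
    by (rule has_derivative_sum)
  then show ?thesis
    unfolding gderiv_def plane_wave_sum_def[abs_def] plane_wave_gradient_def
    by (simp add: inner_sum_right inner_commute)
qed

lemma continuous_on_plane_wave: "continuous_on S (plane_wave_sum vs A d)"
    "continuous_on S (plane_wave_gradient vs A d)"
  unfolding plane_wave_sum_def[abs_def] plane_wave_gradient_def[abs_def]
  by (intro continuous_intros)+

lemma plane_wave_gradient_component:
  "plane_wave_gradient vs A d p \<bullet> b = plane_wave_sum vs (\<lambda>i. A i * (vs ! i \<bullet> b)) (d + pi / 2) p"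
proof -
  have "cos (vs ! i \<bullet> p + (d + pi / 2)) = - sin (vs ! i \<bullet> p + d)" for i
    by (simp add: cos_add sin_add algebra_simps)
  then show ?thesis
    by (simp add: plane_wave_gradient_def plane_wave_sum_def inner_sum_left algebra_simps)
qed

lemma plane_wave_laplacian:
  fixes vs :: "'a::euclidean_space list"
  assumes "\<And>i. i < length vs \<Longrightarrow> vs ! i \<bullet> vs ! i = \<mu>"
  shows "(\<Sum>b\<in>Basis. plane_wave_gradient vs (\<lambda>i. A i * (vs ! i \<bullet> b)) (d + pi / 2) p \<bullet> b) = - \<mu> * plane_wave_sum vs A d p"
proof -
  have s: "sin (vs ! i \<bullet> p + (d + pi / 2)) = cos (vs ! i \<bullet> p + d)" for i
    by (simp add: cos_add sin_add algebra_simps)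
  have "(\<Sum>b\<in>Basis. plane_wave_gradient vs (\<lambda>i. A i * (vs ! i \<bullet> b)) (d + pi / 2) p \<bullet> b) =
      (\<Sum>i<length vs. \<Sum>b\<in>Basis. - (A i * cos (vs ! i \<bullet> p + d)) * ((vs ! i \<bullet> b) * (vs ! i \<bullet> b)))"
    unfolding plane_wave_gradient_def inner_sum_left s
    by (subst sum.swap) (simp add: mult_ac)
  also have "\<dots> = (\<Sum>i<length vs. - (A i * cos (vs ! i \<bullet> p + d)) * (vs ! i \<bullet> vs ! i))"
    unfolding sum_distrib_left[symmetric] euclidean_inner[symmetric] ..
  also have "\<dots> = - \<mu> * plane_wave_sum vs A d p"
    unfolding plane_wave_sum_def sum_distrib_left by (intro sum.cong) (simp_all add: assms)
  finally show ?thesis .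
qed

text \<open>This is \<open>j a + k b + l c\<close> for the vectors \<open>a = (2\<pi>/3) (1, \<surd>3)\<close>, \<open>b = (2\<pi>/3) (1, -\<surd>3)\<close> and
  \<open>c = (2\<pi>/3) (-2, 0)\<close>, which have sum 0. The linear part of the reflection in a side of the
  triangle acts on the frequencies by exchanging two of the three coefficients.\<close>

definition freq :: "int \<Rightarrow> int \<Rightarrow> int \<Rightarrow> real \<times> real"
  where "freq j k l = (2 * pi / 3 * (j + k - 2 * l), 2 * pi / 3 * sqrt 3 * (j - k))"

definition orbit :: "int \<Rightarrow> int \<Rightarrow> int \<Rightarrow> (real \<times> real) list"
  where "orbit j k l = [freq j k l, freq k j l, freq j l k, freq l j k, freq l k j, freq k l j]"

definition triangle_wave :: "int \<Rightarrow> int \<Rightarrow> int \<Rightarrow> real \<Rightarrow> real \<times> real \<Rightarrow> real"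
  where "triangle_wave j k l d = plane_wave_sum (orbit j k l) (\<lambda>_. 1) d"

lemma length_orbit [simp]: "length (orbit j k l) = 6"
  by (simp add: orbit_def)

lemma sum_lessThan_6: "(\<Sum>i<6. f (i::nat)) = f 0 + f 1 + f 2 + f 3 + f 4 + (f 5 :: 'a::comm_monoid_add)"
  by (simp add: eval_nat_numeral lessThan_Suc algebra_simps)

lemma triangle_wave_eq:
  "triangle_wave j k l d p = cos (freq j k l \<bullet> p + d) + cos (freq k j l \<bullet> p + d) + cos (freq j l k \<bullet> p + d)
     + cos (freq l j k \<bullet> p + d) + cos (freq l k j \<bullet> p + d) + cos (freq k l j \<bullet> p + d)"
  by (simp add: triangle_wave_def plane_wave_sum_def sum_lessThan_6) (simp add: orbit_def)

text \<open>The square of the length of the vectors \<open>a\<close>, \<open>b\<close>, \<open>c\<close>; it is the smallest positive eigenvalue.\<close>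

definition eigen_unit :: real
  where "eigen_unit = 16 * pi\<^sup>2 / 9"

lemma freq_norm: "freq j k l \<bullet> freq j k l = eigen_unit * of_int (j\<^sup>2 + k\<^sup>2 + l\<^sup>2 - j * k - k * l - j * l)"
proof -
  have "freq j k l \<bullet> freq j k l = 4 * pi\<^sup>2 / 9 * ((j + k - 2 * l)\<^sup>2 + sqrt 3 * sqrt 3 * (j - k)\<^sup>2)"
    unfolding freq_def inner_Pair inner_real_def by (simp add: power2_eq_square field_simps)
  also have "\<dots> = eigen_unit * of_int (j\<^sup>2 + k\<^sup>2 + l\<^sup>2 - j * k - k * l - j * l)"
    by (simp add: eigen_unit_def power2_eq_square field_simps)
  finally show ?thesis .
qed

lemma orbit_norm:
  assumes "i < 6"
  shows "orbit j k l ! i \<bullet> orbit j k l ! i = eigen_unit * of_int (j\<^sup>2 + k\<^sup>2 + l\<^sup>2 - j * k - k * l - j * l)"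
proof -
  have "i \<in> {0, 1, 2, 3, 4, 5}"
    using assms by auto
  then show ?thesis
    by (auto simp: orbit_def freq_norm algebra_simps)
qed

text \<open>\<open>P\<close> and \<open>Q\<close> are mirror images under the linear reflection with normal \<open>n\<close>, hence the opposite normal
  components. On the hyperplane \<open>n \<bullet> x + c = 0\<close> the two phases differ by a multiple of \<open>2\<pi>\<close>, so at height \<open>s\<close> above it the two sines differ by at
  most the remaining phase \<open>2\<pi>\<bar>m\<bar>s\<close>.\<close>

lemma reflected_waves_flux:
  fixes P Q n x :: "'a::real_inner"
  assumes PQ: "P - Q = (2 * pi * of_int m) *\<^sub>R n"
    and flux: "P \<bullet> n = 4 * pi / 3 * of_int m" "Q \<bullet> n = - (4 * pi / 3 * of_int m)"
    and s: "s = n \<bullet> x + of_int c" "s \<ge> 0"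
  shows "\<bar>sin (P \<bullet> x + d) * (P \<bullet> n) + sin (Q \<bullet> x + d) * (Q \<bullet> n)\<bar> \<le> (8 * pi\<^sup>2 / 3 * (of_int m)\<^sup>2) * s"
proof -
  let ?y = "Q \<bullet> x + d" and ?t = "2 * pi * of_int m * s"
  have "P \<bullet> x = Q \<bullet> x + 2 * pi * of_int m * (n \<bullet> x)"
    using arg_cong[OF PQ, of "\<lambda>v. v \<bullet> x"] by (simp add: inner_diff_left)
  \<comment> \<open>the offset \<open>c\<close> is an integer, so it only contributes whole periods\<close>
  then have "P \<bullet> x + d = (?y + ?t) - (2 * pi) * of_int (m * c)"
    using s(1) by (simp add: algebra_simps)
  then have "sin (P \<bullet> x + d) = sin (?y + ?t)"
    by (simp only: sin_diff sin_int_2pin cos_int_2pin)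
  then have "sin (P \<bullet> x + d) - sin ?y = 2 * sin (?t / 2) * cos ((?y + ?t + ?y) / 2)"
    using sin_diff_sin[of "?y + ?t" ?y] by simp
  then have "\<bar>sin (P \<bullet> x + d) - sin ?y\<bar> = 2 * (\<bar>sin (?t / 2)\<bar> * \<bar>cos ((?y + ?t + ?y) / 2)\<bar>)"
    by (simp add: abs_mult)
  also have "\<dots> \<le> 2 * (\<bar>?t / 2\<bar> * 1)"
    by (intro mult_left_mono mult_mono abs_sin_x_le_abs_x abs_cos_le_one) auto
  finally have b: "\<bar>sin (P \<bullet> x + d) - sin ?y\<bar> \<le> \<bar>?t\<bar>"
    by simp
  have "sin (P \<bullet> x + d) * (P \<bullet> n) + sin ?y * (Q \<bullet> n) = (sin (P \<bullet> x + d) - sin ?y) * (P \<bullet> n)"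
    using flux by (simp add: algebra_simps)
  then have "\<bar>sin (P \<bullet> x + d) * (P \<bullet> n) + sin ?y * (Q \<bullet> n)\<bar> \<le> \<bar>?t\<bar> * \<bar>P \<bullet> n\<bar>"
    using mult_right_mono[OF b, of "\<bar>P \<bullet> n\<bar>"] by (simp add: abs_mult)
  also have "\<dots> = (8 * pi\<^sup>2 / 3 * (of_int m)\<^sup>2) * s"
    using s(2) by (simp add: flux abs_mult power2_eq_square)
  finally show ?thesis .
qed

lemma freq_reflections:
  "freq j k l - freq k j l = (2 * pi * of_int (j - k)) *\<^sub>R (0, 2 * sqrt 3 / 3)"
  "freq j k l \<bullet> (0, 2 * sqrt 3 / 3) = 4 * pi / 3 * of_int (j - k)"
  "freq j k l - freq j l k = (2 * pi * of_int (k - l)) *\<^sub>R (1, - sqrt 3 / 3)"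
  "freq j k l \<bullet> (1, - sqrt 3 / 3) = 4 * pi / 3 * of_int (k - l)"
  "freq j k l - freq l k j = (2 * pi * of_int (l - j)) *\<^sub>R (-1, - sqrt 3 / 3)"
  "freq j k l \<bullet> (-1, - sqrt 3 / 3) = 4 * pi / 3 * of_int (l - j)"
  by (simp_all add: freq_def field_simps)

text \<open>For each side the six waves of an orbit split into three pairs of mirror images.\<close>

lemma triangle_wave_flux:
  assumes p: "p \<in> equilateral_triangle" and i: "i \<in> triangle_sides"
  shows "\<bar>plane_wave_gradient (orbit j k l) (\<lambda>_. 1) d p \<bullet> fst i\<bar> \<le>
    (8 * pi\<^sup>2 / 3 * ((of_int (j - k))\<^sup>2 + (of_int (j - l))\<^sup>2 + (of_int (k - l))\<^sup>2)) * (fst i \<bullet> p + snd i)"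
proof -
  have pos: "fst i \<bullet> p + snd i \<ge> 0" if "i \<in> triangle_sides" for i
    using p that unfolding equilateral_triangle_eq_sides by (auto intro: less_imp_le)
  let ?n0 = "(0, 2 * sqrt 3 / 3) :: real \<times> real" and ?n1 = "(1, - sqrt 3 / 3) :: real \<times> real"
    and ?n2 = "(-1, - sqrt 3 / 3) :: real \<times> real"
  have pos: "?n0 \<bullet> p + of_int 0 \<ge> 0" "?n1 \<bullet> p + of_int 0 \<ge> 0" "?n2 \<bullet> p + of_int 1 \<ge> 0"
    using pos[of "(?n0, 0)"] pos[of "(?n1, 0)"] pos[of "(?n2, 1)"] by (simp_all add: triangle_sides_def)
  have flux: "plane_wave_gradient (orbit j k l) (\<lambda>_. 1) d p \<bullet> n =
     - (sin (freq j k l \<bullet> p + d) * (freq j k l \<bullet> n) + sin (freq k j l \<bullet> p + d) * (freq k j l \<bullet> n)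
     + sin (freq j l k \<bullet> p + d) * (freq j l k \<bullet> n) + sin (freq l j k \<bullet> p + d) * (freq l j k \<bullet> n)
     + sin (freq l k j \<bullet> p + d) * (freq l k j \<bullet> n) + sin (freq k l j \<bullet> p + d) * (freq k l j \<bullet> n))" for n
    unfolding plane_wave_gradient_def length_orbit sum_lessThan_6
    by (simp add: inner_add_left) (simp add: orbit_def inner_diff_left)
  have n0: "\<bar>sin (freq j k l \<bullet> p + d) * (freq j k l \<bullet> ?n0) + sin (freq k j l \<bullet> p + d) * (freq k j l \<bullet> ?n0)\<bar>
      \<le> (8 * pi\<^sup>2 / 3 * (of_int (j - k))\<^sup>2) * (?n0 \<bullet> p + of_int 0)" for j k l
    by (rule reflected_waves_flux[OF _ _ _ refl pos(1)]) (simp_all only: freq_reflections of_int_diff, simp add: algebra_simps)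
  have n1: "\<bar>sin (freq j k l \<bullet> p + d) * (freq j k l \<bullet> ?n1) + sin (freq j l k \<bullet> p + d) * (freq j l k \<bullet> ?n1)\<bar>
      \<le> (8 * pi\<^sup>2 / 3 * (of_int (k - l))\<^sup>2) * (?n1 \<bullet> p + of_int 0)" for j k l
    by (rule reflected_waves_flux[OF _ _ _ refl pos(2)]) (simp_all only: freq_reflections of_int_diff, simp add: algebra_simps)
  have n2: "\<bar>sin (freq j k l \<bullet> p + d) * (freq j k l \<bullet> ?n2) + sin (freq l k j \<bullet> p + d) * (freq l k j \<bullet> ?n2)\<bar>
      \<le> (8 * pi\<^sup>2 / 3 * (of_int (l - j))\<^sup>2) * (?n2 \<bullet> p + of_int 1)" for j k l
    by (rule reflected_waves_flux[OF _ _ _ refl pos(3)]) (simp_all only: freq_reflections of_int_diff, simp add: algebra_simps)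
  have sq: "(of_int (k - j))\<^sup>2 = ((of_int (j - k))\<^sup>2 :: real)" for j k
    by (simp add: power2_commute)
  define K :: real where "K = 8 * pi\<^sup>2 / 3"
  define X Y Z :: real where "X = (of_int (j - k))\<^sup>2" and "Y = (of_int (j - l))\<^sup>2" and "Z = (of_int (k - l))\<^sup>2"
  have D: "(K * (X + Y + Z)) * s = K * X * s + K * Y * s + K * Z * s" for s
    by (simp add: algebra_simps)
  consider "i = (?n0, 0)" | "i = (?n1, 0)" | "i = (?n2, 1)"
    using i by (auto simp: triangle_sides_def)
  then show ?thesis
  proof cases
    case 1
    show ?thesis
      using n0[of j k l] n0[of j l k] n0[of k l j]
      unfolding 1 fst_conv snd_conv flux X_def[symmetric] Y_def[symmetric] Z_def[symmetric] K_def[symmetric] D of_int_0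
      by linarith
  next
    case 2
    show ?thesis
      using n1[of j k l] n1[of k j l] n1[of l j k]
      unfolding 2 fst_conv snd_conv flux X_def[symmetric] Y_def[symmetric] Z_def[symmetric] K_def[symmetric] D of_int_0
      by linarith
  next
    case 3
    show ?thesis
      using n2[of j k l] n2[of l j k] n2[of j l k]
      unfolding 3 fst_conv snd_conv flux sq[of l j] sq[of k j] X_def[symmetric] Y_def[symmetric] Z_def[symmetric] K_def[symmetric] D of_int_1
      by linarith
  qed
qed

text \<open>The restriction to the triangle in the normal form used for eigenfunctions, which vanish outside
  the domain.\<close>

definition triangle_mode :: "int \<Rightarrow> int \<Rightarrow> int \<Rightarrow> real \<Rightarrow> real \<times> real \<Rightarrow> real"
  where "triangle_mode j k l d p = (if p \<in> equilateral_triangle then triangle_wave j k l d p else 0)"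

lemma continuous_on_triangle_wave: "continuous_on S (triangle_wave j k l d)"
  unfolding triangle_wave_def by (rule continuous_on_plane_wave)

lemma triangle_mode_in_eigenspace:
  "triangle_mode j k l d \<in> neumann_eigenspace equilateral_triangle
     (eigen_unit * of_int (j\<^sup>2 + k\<^sup>2 + l\<^sup>2 - j * k - k * l - j * l))"
proof -
  let ?\<mu> = "eigen_unit * of_int (j\<^sup>2 + k\<^sup>2 + l\<^sup>2 - j * k - k * l - j * l)"
  let ?w = "\<lambda>b i. 1 * (orbit j k l ! i \<bullet> b)"
  have "neumann_laplacian equilateral_triangle (triangle_mode j k l d) (\<lambda>p. ?\<mu> * triangle_mode j k l d p)"
  proof (rule neumann_laplacian_of_tangential_gradient[OF finite_triangle_sides equilateral_triangle_eq_sides bounded_triangle])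
    show "GDERIV (triangle_wave j k l d) p :> plane_wave_gradient (orbit j k l) (\<lambda>_. 1) d p" for p
      unfolding triangle_wave_def by (rule gderiv_plane_wave_sum)
    show "GDERIV (\<lambda>p. plane_wave_gradient (orbit j k l) (\<lambda>_. 1) d p \<bullet> b) p :>
        plane_wave_gradient (orbit j k l) (?w b) (d + pi / 2) p" for b p
      unfolding plane_wave_gradient_component by (rule gderiv_plane_wave_sum)
    show "triangle_mode j k l d p = triangle_wave j k l d p" if "p \<in> equilateral_triangle" for p
      using that by (simp add: triangle_mode_def)
    show "?\<mu> * triangle_mode j k l d p =
        - (\<Sum>b\<in>Basis. plane_wave_gradient (orbit j k l) (?w b) (d + pi / 2) p \<bullet> b)"
      if "p \<in> equilateral_triangle" for p
      using that plane_wave_laplacian[of "orbit j k l" ?\<mu> "\<lambda>_. 1" d p] orbit_norm[of _ j k l]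
      by (simp add: triangle_mode_def triangle_wave_def)
    let ?L = "8 * pi\<^sup>2 / 3 * ((of_int (j - k))\<^sup>2 + (of_int (j - l))\<^sup>2 + (of_int (k - l))\<^sup>2)"
    show "\<bar>plane_wave_gradient (orbit j k l) (\<lambda>_. 1) d p \<bullet> fst i\<bar> \<le> ?L * (fst i \<bullet> p + snd i)"
      if "p \<in> equilateral_triangle" "i \<in> triangle_sides" for i p
      using that by (rule triangle_wave_flux)
    show "0 \<le> ?L"
      by simp
  qed (intro continuous_on_plane_wave)+
  moreover have "continuous_on equilateral_triangle (triangle_mode j k l d)"
    using continuous_on_triangle_wave[of equilateral_triangle j k l d]
    by (rule continuous_on_eq) (simp add: triangle_mode_def)
  ultimately show ?thesis
    unfolding neumann_eigenspace_eq[OF bounded_triangle triangle_borel]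
    by (simp add: triangle_mode_def)
qed

section \<open>Completeness of the symmetric waves\<close>

text \<open>The linear span of the symmetric waves. Arbitrary real phases are included so that sums and
  differences of phases, which arise from products, stay inside.\<close>

inductive_set wave_algebra :: "(real \<times> real \<Rightarrow> real) set" where
  wave: "triangle_wave j k l d \<in> wave_algebra"
| add: "f \<in> wave_algebra \<Longrightarrow> g \<in> wave_algebra \<Longrightarrow> (\<lambda>p. f p + g p) \<in> wave_algebra"
| scale: "f \<in> wave_algebra \<Longrightarrow> (\<lambda>p. c * f p) \<in> wave_algebra"

lemma freq_add: "freq (j + j') (k + k') (l + l') = freq j k l + freq j' k' l'"
  and freq_diff: "freq (j - j') (k - k') (l - l') = freq j k l - freq j' k' l'"
  by (simp_all add: freq_def field_simps)

lemma cos_wave_product: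
  "cos (freq j k l \<bullet> p + d) * cos (freq j' k' l' \<bullet> p + d') =
    (cos (freq (j - j') (k - k') (l - l') \<bullet> p + (d - d')) + cos (freq (j + j') (k + k') (l + l') \<bullet> p + (d + d'))) / 2"
  unfolding cos_times_cos freq_add freq_diff by (simp add: inner_add_left inner_diff_left algebra_simps)

text \<open>Adding the product-to-sum formula over the six permutations, applied to both frequencies
  simultaneously, yields symmetric waves again.\<close>

lemma triangle_wave_pairing:
  "cos (freq j k l \<bullet> p + d) * cos (freq j' k' l' \<bullet> p + d') + cos (freq k j l \<bullet> p + d) * cos (freq k' j' l' \<bullet> p + d')
   + cos (freq j l k \<bullet> p + d) * cos (freq j' l' k' \<bullet> p + d') + cos (freq l j k \<bullet> p + d) * cos (freq l' j' k' \<bullet> p + d')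
   + cos (freq l k j \<bullet> p + d) * cos (freq l' k' j' \<bullet> p + d') + cos (freq k l j \<bullet> p + d) * cos (freq k' l' j' \<bullet> p + d')
   = (1/2) * (triangle_wave (j - j') (k - k') (l - l') (d - d') p + triangle_wave (j + j') (k + k') (l + l') (d + d') p)"
  unfolding cos_wave_product triangle_wave_eq by (simp add: field_simps)

text \<open>The product of two orbit sums is a sum over pairs of permutations. Fixing the relative permutation
  and summing over the common one leaves six instances of the pairing identity.\<close>

lemma triangle_wave_product:
  "(\<lambda>p. triangle_wave j k l d p * triangle_wave j' k' l' d' p) \<in> wave_algebra"
proof -
  define P where "P a b c p = (1/2) * (triangle_wave (j - a) (k - b) (l - c) (d - d') p + triangle_wave (j + a) (k + b) (l + c) (d + d') p)" for a b c p
  have P: "P a b c \<in> wave_algebra" for a b c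
    unfolding P_def[abs_def] by (intro wave_algebra.intros)
  have "triangle_wave j k l d p * triangle_wave j' k' l' d' p =
      P j' k' l' p + P k' j' l' p + P j' l' k' p + P l' j' k' p + P l' k' j' p + P k' l' j' p" for p
    unfolding P_def triangle_wave_pairing[symmetric]
    unfolding triangle_wave_eq by (simp only: distrib_left distrib_right ac_simps)
  then have "(\<lambda>p. triangle_wave j k l d p * triangle_wave j' k' l' d' p) =
      (\<lambda>p. P j' k' l' p + P k' j' l' p + P j' l' k' p + P l' j' k' p + P l' k' j' p + P k' l' j' p)"
    by blast
  then show ?thesis
    by (simp only:) (intro wave_algebra.add P)
qed

lemma wave_algebra_mult:
  assumes "f \<in> wave_algebra" "g \<in> wave_algebra"
  shows "(\<lambda>p. f p * g p) \<in> wave_algebra"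
  using assms
proof (induction f)
  case (wave j k l d)
  from wave show ?case
  proof (induction g)
    case (wave j' k' l' d')
    show ?case by (rule triangle_wave_product)
  next
    case (add f g)
    then show ?case
      using wave_algebra.add[of "\<lambda>p. triangle_wave j k l d p * f p" "\<lambda>p. triangle_wave j k l d p * g p"]
      by (simp add: distrib_left)
  next
    case (scale f c)
    then show ?case
      using wave_algebra.scale[of "\<lambda>p. triangle_wave j k l d p * f p" c] by (simp add: mult.left_commute)
  qed
next
  case (add f1 f2)
  then show ?case
    using wave_algebra.add[of "\<lambda>p. f1 p * g p" "\<lambda>p. f2 p * g p"] by (simp add: distrib_right)
next
  case (scale f c)
  then show ?case
    using wave_algebra.scale[of "\<lambda>p. f p * g p" c] by (simp add: mult.assoc)
qed

lemma wave_algebra_const: "(\<lambda>_. c) \<in> wave_algebra"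
proof -
  have "(\<lambda>p. c / 6 * triangle_wave 0 0 0 0 p) \<in> wave_algebra"
    by (intro wave_algebra.intros)
  moreover have "triangle_wave 0 0 0 0 p = 6" for p
    by (cases p) (simp add: triangle_wave_eq freq_def)
  ultimately show ?thesis by simp
qed

lemma continuous_on_wave_algebra: "f \<in> wave_algebra \<Longrightarrow> continuous_on S f"
  by (induction rule: wave_algebra.induct) (auto intro!: continuous_intros continuous_on_triangle_wave)

text \<open>For unit numbers with product 1 the second elementary symmetric function is the conjugate of the
  first. Hence the sum determines the monic cubic polynomial with these three roots, and so the roots
  up to order.\<close>

lemma unit_triples_eq_if_sums_eq:
  fixes x y z x' y' z' :: complex
  assumes n: "norm x = 1" "norm y = 1" "norm z = 1" "norm x' = 1" "norm y' = 1" "norm z' = 1"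
    and p: "x * y * z = 1" "x' * y' * z' = 1" and s: "x + y + z = x' + y' + z'"
  shows "x' = x \<and> y' = y \<and> z' = z \<or> x' = x \<and> y' = z \<and> z' = y \<or> x' = y \<and> y' = x \<and> z' = z
    \<or> x' = y \<and> y' = z \<and> z' = x \<or> x' = z \<and> y' = x \<and> z' = y \<or> x' = z \<and> y' = y \<and> z' = x"
proof -
  have e2: "a * b + b * c + a * c = cnj (a + b + c)" if "norm a = 1" "norm b = 1" "norm c = 1" "a * b * c = 1" for a b c :: complex
  proof -
    have u: "a * cnj a = 1" "b * cnj b = 1" "c * cnj c = 1"
      using that by (simp_all add: complex_norm_square[symmetric])
    have conj: "cnj z = x * y" if "z * cnj z = 1" "x * y * z = 1" for x y z :: complex
    proof -
      have "cnj z = x * y * z * cnj z"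
        unfolding that(2) by simp
      also have "\<dots> = x * y"
        unfolding mult.assoc[of "x * y"] that(1) by simp
      finally show ?thesis .
    qed
    have "b * c * a = 1" "a * c * b = 1"
      using that(4) by (simp_all only: ac_simps)
    then have "cnj c = a * b" "cnj a = b * c" "cnj b = a * c"
      using conj[OF u(3) that(4)] conj[OF u(1)] conj[OF u(2)] by blast+
    then show ?thesis
      by simp
  qed
  have e: "x * y + y * z + x * z = x' * y' + y' * z' + x' * z'"
    using e2[of x y z] e2[of x' y' z'] n p s by simp
  have "(x' - x) * (x' - y) * (x' - z) = x' ^ 3 - (x + y + z) * x'\<^sup>2 + (x * y + y * z + x * z) * x' - x * y * z"
    by (simp add: algebra_simps power2_eq_square power3_eq_cube)
  also have "\<dots> = 0"
  proof -
    have "x' ^ 3 - (x' + y' + z') * x'\<^sup>2 + (x' * y' + y' * z' + x' * z') * x' - x' * y' * z' = 0"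
      by (simp add: algebra_simps power2_eq_square power3_eq_cube)
    then show ?thesis
      unfolding e s p .
  qed
  finally have roots: "x' = x \<or> x' = y \<or> x' = z"
    by auto
  \<comment> \<open>once one root is matched, the other two agree in sum and product\<close>
  have two: "y' = b \<and> z' = c \<or> y' = c \<and> z' = b"
    if "x' = a" "a + b + c = x' + y' + z'" "a * b + b * c + a * c = x' * y' + y' * z' + x' * z'" for a b c
  proof -
    have sum: "b + c = y' + z'"
      using that by simp
    then have "a * b + a * c = x' * y' + x' * z'"
      using that(1) by (simp add: distrib_left[symmetric])
    then have prod: "b * c = y' * z'"
      using that(3) by algebra
    have "(y' - b) * (y' - c) = y' * y' - (b + c) * y' + b * c"
      by (simp add: algebra_simps)
    also have "\<dots> = 0"
      unfolding sum prod by (simp add: algebra_simps)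
    finally have "y' = b \<or> y' = c"
      by simp
    then show ?thesis
      using sum by (auto simp: algebra_simps)
  qed
  have s2: "y + x + z = x' + y' + z'" and s3: "z + x + y = x' + y' + z'"
    using s by (simp_all only: ac_simps)
  have ey: "y * x + x * z + y * z = x' * y' + y' * z' + x' * z'"
    and ez: "z * x + x * y + z * y = x' * y' + y' * z' + x' * z'"
    using e by (simp_all only: ac_simps)
  from roots show ?thesis
    using two[OF _ s e] two[OF _ s2 ey] two[OF _ s3 ez] by blast
qed

text \<open>The inequalities describe the fundamental domain of the group generated by permutations and by
  integer translations with sum 0: two points of it in the same orbit coincide. All coordinates lie
  between \<open>-2/3\<close> and \<open>2/3\<close>, so only finitely many translations are possible, and each case is linear.\<close>

lemma alcove_fundamental:
  fixes a b c a' b' c' :: real and n1 n2 n3 :: int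
  assumes o: "c \<le> b" "b \<le> a" "a \<le> c + 1" "a + b + c = 0"
    and o': "c' \<le> b'" "b' \<le> a'" "a' \<le> c' + 1" "a' + b' + c' = 0"
    and perm: "x = a \<and> y = b \<and> z = c \<or> x = a \<and> y = c \<and> z = b \<or> x = b \<and> y = a \<and> z = c
      \<or> x = b \<and> y = c \<and> z = a \<or> x = c \<and> y = a \<and> z = b \<or> x = c \<and> y = b \<and> z = a"
    and eq: "a' = x + of_int n1" "b' = y + of_int n2" "c' = z + of_int n3"
  shows "a' = a \<and> b' = b \<and> c' = c"
proof -
  have x: "- 2/3 \<le> x" "x \<le> 2/3" "- 2/3 \<le> y" "y \<le> 2/3" "- 2/3 \<le> z" "z \<le> 2/3" "x + y + z = 0"
    using o perm by auto
  have "of_int (-1) < (of_int n1 :: real)" "of_int n1 < (of_int 2 :: real)"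
    "of_int (-2) < (of_int n2 :: real)" "of_int n2 < (of_int 2 :: real)"
    using x o' eq by auto
  then have n: "n1 \<in> {0, 1}" "n2 \<in> {-1, 0, 1}"
    unfolding of_int_less_iff by auto
  have "of_int (n1 + n2 + n3) = (of_int 0 :: real)"
    using x o' eq by simp
  then have "n3 = - n1 - n2"
    unfolding of_int_eq_iff by simp
  then have "of_int n3 = (- of_int n1 - of_int n2 :: real)"
    by simp
  with n perm o o' eq show ?thesis
    by auto
qed

lemma sin_cos_sums_determine_angles:
  fixes a b c a' b' c' :: real
  assumes o: "c \<le> b" "b \<le> a" "a \<le> c + 1" "a + b + c = 0"
    and o': "c' \<le> b'" "b' \<le> a'" "a' \<le> c' + 1" "a' + b' + c' = 0"
    and cos: "cos (2 * pi * a) + cos (2 * pi * b) + cos (2 * pi * c) = cos (2 * pi * a') + cos (2 * pi * b') + cos (2 * pi * c')"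
    and sin: "sin (2 * pi * a) + sin (2 * pi * b) + sin (2 * pi * c) = sin (2 * pi * a') + sin (2 * pi * b') + sin (2 * pi * c')"
  shows "a' = a \<and> b' = b \<and> c' = c"
proof -
  let ?e = "\<lambda>t. cis (2 * pi * t)"
  have "?e a * ?e b * ?e c = ?e (a + b + c)" "?e a' * ?e b' * ?e c' = ?e (a' + b' + c')"
    by (simp_all add: cis_mult distrib_left)
  then have prod: "?e a * ?e b * ?e c = 1" "?e a' * ?e b' * ?e c' = 1"
    using o(4) o'(4) by simp_all
  have sum: "?e a + ?e b + ?e c = ?e a' + ?e b' + ?e c'"
    using cos sin by (simp add: complex_eq_iff)
  have shift: "\<exists>n::int. t = s + of_int n" if "?e t = ?e s" for t s
  proof -
    have "sin (2 * pi * t) = sin (2 * pi * s) \<and> cos (2 * pi * t) = cos (2 * pi * s)"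
      using that by (simp add: complex_eq_iff)
    then obtain n :: int where "2 * pi * t = 2 * pi * s + 2 * pi * of_int n"
      unfolding sin_cos_eq_iff by blast
    then have "2 * pi * t = 2 * pi * (s + of_int n)"
      by (simp add: distrib_left)
    then have "t = s + of_int n"
      by simp
    then show ?thesis ..
  qed
  obtain x y z where perm: "x = a \<and> y = b \<and> z = c \<or> x = a \<and> y = c \<and> z = b \<or> x = b \<and> y = a \<and> z = c
      \<or> x = b \<and> y = c \<and> z = a \<or> x = c \<and> y = a \<and> z = b \<or> x = c \<and> y = b \<and> z = a"
    and e: "?e a' = ?e x" "?e b' = ?e y" "?e c' = ?e z"
    using unit_triples_eq_if_sums_eq[OF _ _ _ _ _ _ prod sum] by (simp add: norm_cis) blast
  obtain n1 n2 n3 :: int where "a' = x + of_int n1" "b' = y + of_int n2" "c' = z + of_int n3"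
    using shift[OF e(1)] shift[OF e(2)] shift[OF e(3)] by blast
  then show ?thesis
    by (rule alcove_fundamental[OF o o' perm])
qed

lemma closure_triangle_subset:
  "closure equilateral_triangle \<subseteq> {p. 0 \<le> snd p \<and> snd p \<le> sqrt 3 * fst p \<and> sqrt 3 * fst p + snd p \<le> sqrt 3}"
proof (rule closure_minimal)
  show "closed {p. 0 \<le> snd p \<and> snd p \<le> sqrt 3 * fst p \<and> sqrt 3 * fst p + snd p \<le> sqrt 3}"
    by (intro closed_Collect_conj closed_Collect_le continuous_intros)
qed (auto simp: in_triangle_iff)

text \<open>The phases \<open>0\<close> and \<open>-\<pi>/2\<close> give the real and the imaginary part of the sum of the three unit numbers
  with arguments \<open>a \<bullet> p\<close>, \<open>b \<bullet> p\<close>, \<open>c \<bullet> p\<close>. This sum determines the arguments up to order and multiples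
  of \<open>2\<pi>\<close>, and the closed triangle corresponds to a fundamental domain.\<close>

lemma waves_separate_points:
  assumes p: "p \<in> closure equilateral_triangle" and q: "q \<in> closure equilateral_triangle"
    and eq: "\<And>d. triangle_wave 1 0 0 d p = triangle_wave 1 0 0 d q"
  shows "p = q"
proof -
  define a b c where "a p = (fst p + sqrt 3 * snd p) / 3" and "b p = (fst p - sqrt 3 * snd p) / 3"
    and "c p = - 2 * fst p / 3" for p :: "real \<times> real"
  have f: "freq 1 0 0 \<bullet> p = 2 * pi * a p" "freq 0 1 0 \<bullet> p = 2 * pi * b p" "freq 0 0 1 \<bullet> p = 2 * pi * c p" for p
    by (cases p; simp add: freq_def a_def b_def c_def field_simps)+
  have o: "c p \<le> b p" "b p \<le> a p" "a p \<le> c p + 1" "a p + b p + c p = 0" if "p \<in> closure equilateral_triangle" for p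
  proof -
    from that have h: "0 \<le> snd p" "snd p \<le> sqrt 3 * fst p" "sqrt 3 * fst p + snd p \<le> sqrt 3"
      using closure_triangle_subset by auto
    have "sqrt 3 * snd p \<le> sqrt 3 * (sqrt 3 * fst p)" "sqrt 3 * (sqrt 3 * fst p + snd p) \<le> sqrt 3 * sqrt 3"
      "0 \<le> sqrt 3 * snd p"
      using h by (intro mult_left_mono mult_nonneg_nonneg; simp)+
    then show "c p \<le> b p" "b p \<le> a p" "a p \<le> c p + 1" "a p + b p + c p = 0"
      by (simp_all add: a_def b_def c_def distrib_left field_simps)
  qed
  have w: "triangle_wave 1 0 0 d p = 2 * (cos (2 * pi * a p + d) + cos (2 * pi * b p + d) + cos (2 * pi * c p + d))" for d p
    by (simp add: triangle_wave_eq f)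
  have cos: "cos (2 * pi * a p) + cos (2 * pi * b p) + cos (2 * pi * c p) = cos (2 * pi * a q) + cos (2 * pi * b q) + cos (2 * pi * c q)"
    using eq[of 0] by (simp add: w)
  have "cos (x + - (pi / 2)) = sin x" for x :: real
    by (simp add: cos_diff)
  then have sin: "sin (2 * pi * a p) + sin (2 * pi * b p) + sin (2 * pi * c p) = sin (2 * pi * a q) + sin (2 * pi * b q) + sin (2 * pi * c q)"
    using eq[of "- (pi / 2)"] by (simp only: w) simp
  have "a q = a p \<and> b q = b p \<and> c q = c p"
    by (rule sin_cos_sums_determine_angles[OF o[OF p] o[OF q] cos sin])
  then have "fst q = fst p" "sqrt 3 * snd q = sqrt 3 * snd p"
    by (auto simp: a_def c_def)
  then show ?thesis
    by (auto simp: prod_eq_iff)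
qed

lemma wave_algebra_dense:
  assumes "continuous_on (closure equilateral_triangle) f" "e > 0"
  shows "\<exists>g\<in>wave_algebra. \<forall>p\<in>closure equilateral_triangle. \<bar>f p - g p\<bar> < e"
proof -
  interpret function_ring_on wave_algebra "closure equilateral_triangle"
  proof
    show "compact (closure equilateral_triangle)"
      using bounded_triangle by simp
    show "\<exists>f\<in>wave_algebra. f x \<noteq> f y"
      if "x \<in> closure equilateral_triangle" "y \<in> closure equilateral_triangle" "x \<noteq> y" for x y
      using waves_separate_points[OF that(1,2)] that(3) wave_algebra.wave by blast
  qed (auto intro: continuous_on_wave_algebra wave_algebra.add wave_algebra_mult wave_algebra_const)
  show ?thesis
    by (rule Stone_Weierstrass_basic) fact+
qed

text \<open>By density \<open>u\<close> is orthogonal to every continuous function on the plane. A nonzero value of \<open>u\<close> is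
  refuted by a cone-shaped bump around that point with the sign of \<open>u\<close>.\<close>

lemma orthogonal_to_waves_imp_zero:
  assumes cont: "continuous_on equilateral_triangle u" and u: "square_integrable_on u equilateral_triangle"
    and orth: "\<And>j k l d. (LINT p:equilateral_triangle|lborel. u p * triangle_wave j k l d p) = 0"
    and x0: "x0 \<in> equilateral_triangle"
  shows "u x0 = 0"
proof (rule ccontr)
  let ?T = equilateral_triangle
  assume nz: "u x0 \<noteq> 0"
  have iu: "set_integrable lborel ?T u"
    by (rule square_integrable_on_imp_integrable[OF bounded_triangle triangle_borel u])
  have prod_int: "set_integrable lborel ?T (\<lambda>p. u p * f p)" if "continuous_on UNIV f" for f
    by (rule square_integrable_product[OF u square_integrable_on_continuous[OF bounded_triangle triangle_borel that]])
  have alg: "(LINT p:?T|lborel. u p * f p) = 0" if "f \<in> wave_algebra" for f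
    using that
  proof induction
    case (wave j k l d)
    show ?case by (rule orth)
  next
    case (add f g)
    then show ?case
      using prod_int[OF continuous_on_wave_algebra[OF add(1)]] prod_int[OF continuous_on_wave_algebra[OF add(2)]]
      by (simp add: distrib_left)
  next
    case (scale f c)
    then show ?case
      by (simp add: mult.left_commute[of _ c])
  qed
  have zero: "(LINT p:?T|lborel. u p * f p) = 0" if f: "continuous_on UNIV f" for f :: "real \<times> real \<Rightarrow> real"
  proof -
    define M where "M = (LINT p:?T|lborel. \<bar>u p\<bar>)"
    have iau: "set_integrable lborel ?T (\<lambda>p. \<bar>u p\<bar>)"
      using set_integrable_abs[OF iu] .
    have "M \<ge> 0"
      unfolding M_def set_lebesgue_integral_def by (intro Bochner_Integration.integral_nonneg) simp
    have small: "\<bar>LINT p:?T|lborel. u p * f p\<bar> \<le> e * M" if "e > 0" for e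
    proof -
      obtain g where g: "g \<in> wave_algebra" "\<And>p. p \<in> closure ?T \<Longrightarrow> \<bar>f p - g p\<bar> < e"
        using wave_algebra_dense[OF continuous_on_subset[OF f subset_UNIV] \<open>e > 0\<close>] by blast
      note cg = continuous_on_wave_algebra[OF g(1)]
      have "(LINT p:?T|lborel. u p * f p) = (LINT p:?T|lborel. u p * f p) - (LINT p:?T|lborel. u p * g p)"
        using alg[OF g(1)] by simp
      also have "\<dots> = (LINT p:?T|lborel. u p * (f p - g p))"
        using prod_int[OF f] prod_int[OF cg] by (simp add: right_diff_distrib)
      finally have eq: "(LINT p:?T|lborel. u p * f p) = (LINT p:?T|lborel. u p * (f p - g p))" .
      have "\<bar>LINT p:?T|lborel. u p * (f p - g p)\<bar> \<le> (LINT p|lborel. norm (indicator ?T p *\<^sub>R (u p * (f p - g p))))"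
        unfolding set_lebesgue_integral_def real_norm_def[symmetric] by (rule integral_norm_bound)
      also have "\<dots> \<le> (LINT p|lborel. e * (indicator ?T p *\<^sub>R \<bar>u p\<bar>))"
      proof (rule integral_mono)
        have "set_integrable lborel ?T (\<lambda>p. u p * (f p - g p))"
          by (rule prod_int) (intro continuous_intros f cg)
        then show "integrable lborel (\<lambda>p. norm (indicator ?T p *\<^sub>R (u p * (f p - g p))))"
          unfolding set_integrable_def by (rule integrable_norm)
        show "integrable lborel (\<lambda>p. e * (indicator ?T p *\<^sub>R \<bar>u p\<bar>))"
          using iau unfolding set_integrable_def by (rule integrable_mult_right)
        fix p
        show "norm (indicator ?T p *\<^sub>R (u p * (f p - g p))) \<le> e * (indicator ?T p *\<^sub>R \<bar>u p\<bar>)"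
        proof (cases "p \<in> ?T")
          case True
          then have "\<bar>f p - g p\<bar> \<le> e"
            using g(2)[of p] closure_subset by (auto intro: less_imp_le)
          then show ?thesis
            using True mult_left_mono[of "\<bar>f p - g p\<bar>" e "\<bar>u p\<bar>"] by (simp add: abs_mult mult.commute)
        qed simp
      qed
      also have "\<dots> = e * M"
        by (simp add: M_def set_lebesgue_integral_def)
      finally show ?thesis
        unfolding eq .
    qed
    have "\<bar>LINT p:?T|lborel. u p * f p\<bar> \<le> 0"
    proof (rule field_le_epsilon)
      fix e :: real assume "e > 0"
      then have "\<bar>LINT p:?T|lborel. u p * f p\<bar> \<le> e / (M + 1) * M"
        using \<open>M \<ge> 0\<close> by (intro small) simp
      also have "\<dots> \<le> e"
        using \<open>M \<ge> 0\<close> \<open>e > 0\<close> by (simp add: field_simps)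
      finally show "\<bar>LINT p:?T|lborel. u p * f p\<bar> \<le> 0 + e"
        by simp
    qed
    then show ?thesis by simp
  qed
  have "continuous (at x0) u"
    using cont x0 open_triangle by (simp add: continuous_on_eq_continuous_at)
  then obtain r1 where r1: "r1 > 0" "\<And>x. dist x x0 < r1 \<Longrightarrow> dist (u x) (u x0) < \<bar>u x0\<bar>"
    unfolding continuous_at_eps_delta using nz by (metis zero_less_abs_iff)
  obtain r2 where r2: "r2 > 0" "ball x0 r2 \<subseteq> ?T"
    using open_triangle x0 open_contains_ball by blast
  define r where "r = min r1 r2"
  have r: "r > 0"
    using r1 r2 by (simp add: r_def)
  \<comment> \<open>supported where \<open>u\<close> has the sign of \<open>u x0\<close>, so that \<open>u * h\<close> is nonnegative everywhere\<close>
  define h where "h x = sgn (u x0) * max 0 (r - dist x x0)" for x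
  have ch: "continuous_on UNIV h"
    unfolding h_def by (intro continuous_intros)
  have pos: "u x * h x > 0" if "x \<in> ball x0 r" for x
  proof -
    have "dist (u x) (u x0) < \<bar>u x0\<bar>" "dist x x0 < r"
      using that r1(2)[of x] by (auto simp: r_def dist_commute)
    then have "u x * sgn (u x0) > 0" "max 0 (r - dist x x0) > 0"
      using nz by (auto simp: dist_real_def sgn_if split: if_splits)
    then show ?thesis
      unfolding h_def by (simp only: mult.assoc[symmetric] zero_less_mult_iff) simp
  qed
  have nn: "indicator ?T x *\<^sub>R (u x * h x) \<ge> 0" for x
  proof (cases "x \<in> ball x0 r")
    case True
    then show ?thesis using pos[OF True] by simp
  next
    case False
    then have "h x = 0"
      by (simp add: h_def dist_commute)
    then show ?thesis by simp
  qed
  have "integrable lborel (\<lambda>x. indicator ?T x *\<^sub>R (u x * h x))"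
    using prod_int[OF ch] unfolding set_integrable_def .
  moreover have "(LINT x|lborel. indicator ?T x *\<^sub>R (u x * h x)) = 0"
    using zero[OF ch] unfolding set_lebesgue_integral_def .
  ultimately have "AE x in lborel. indicator ?T x *\<^sub>R (u x * h x) = 0"
    using integral_nonneg_eq_0_iff_AE[of lborel "\<lambda>x. indicator ?T x *\<^sub>R (u x * h x)"] nn by simp
  then have "AE x in lborel. x \<notin> ball x0 r"
  proof (rule AE_mp, intro AE_I2 impI notI)
    fix x assume "indicator ?T x *\<^sub>R (u x * h x) = 0" and x: "x \<in> ball x0 r"
    moreover have "x \<in> ?T"
      using x r2(2) by (auto simp: r_def)
    ultimately show False
      using pos[OF x] by auto
  qed
  then have "ball x0 r \<in> null_sets lborel"
    by (subst AE_iff_null_sets) simp_all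
  then have "negligible (ball x0 r)"
    by (simp add: negligible_iff_null_sets null_sets_completionI)
  then show False
    using open_not_negligible[of "ball x0 r"] r by simp
qed

section \<open>The eigenspaces and the listing of the eigenvalues\<close>

text \<open>Induction on the number of functionals: passing to the kernel of one of them lowers the dimension by
  at most one.\<close>

lemma finite_basis_from_separating_functionals:
  fixes E :: "('a \<Rightarrow> real) set" and F :: "(('a \<Rightarrow> real) \<Rightarrow> real) set"
  assumes "finite F" "fun_vs.subspace E"
    and "\<And>l u v c. l \<in> F \<Longrightarrow> u \<in> E \<Longrightarrow> v \<in> E \<Longrightarrow> l (\<lambda>x. u x + c * v x) = l u + c * l v"
    and "\<And>u. u \<in> E \<Longrightarrow> \<forall>l\<in>F. l u = 0 \<Longrightarrow> u = 0"
  shows "\<exists>B. finite B \<and> \<not> fun_dependent B \<and> fun_span B = E \<and> card B \<le> card F"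
  using assms
proof (induction F arbitrary: E rule: finite_induct)
  case empty
  have "u = 0" if "u \<in> E" for u
    using empty(3)[OF that] by blast
  then have "E = {0}"
    using fun_vs.subspace_0[OF empty(1)] by blast
  then show ?case
    using fun_vs.independent_empty fun_vs.span_empty by (intro exI[of _ "{}"]) auto
next
  case (insert l F)
  have lin: "l (\<lambda>x. u x + c * v x) = l u + c * l v" if "u \<in> E" "v \<in> E" for u v c
    using insert.prems(2)[of l] that by simp
  have E: "(\<lambda>x. u x + c * v x) \<in> E" if "u \<in> E" "v \<in> E" for u v c
    using fun_vs.subspace_add[OF insert.prems(1) that(1) fun_vs.subspace_scale[OF insert.prems(1) that(2), of c]]
    by (simp add: plus_fun_def)
  define E' where "E' = {u \<in> E. l u = 0}"
  have E0: "0 \<in> E"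
    by (rule fun_vs.subspace_0[OF insert.prems(1)])
  have l0: "l 0 = 0"
    using lin[OF E0 E0, of "-1"] by (simp add: zero_fun_def)
  have sub: "fun_vs.subspace E'"
    unfolding fun_vs.subspace_def
  proof (intro conjI ballI allI)
    show "0 \<in> E'"
      using E0 l0 by (simp add: E'_def)
    show "u + v \<in> E'" if "u \<in> E'" "v \<in> E'" for u v
      using that E[of u v 1] lin[of u v 1] by (simp add: E'_def plus_fun_def)
    show "(\<lambda>x. c * u x) \<in> E'" if "u \<in> E'" for c u
      using that E[of 0 u c] lin[of 0 u c] E0 l0 by (simp add: E'_def)
  qed
  have "\<exists>B. finite B \<and> \<not> fun_dependent B \<and> fun_span B = E' \<and> card B \<le> card F"
  proof (rule insert.IH[OF sub])
    show "l' (\<lambda>x. u x + c * v x) = l' u + c * l' v" if "l' \<in> F" "u \<in> E'" "v \<in> E'" for l' u v c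
      using insert.prems(2) that by (simp add: E'_def)
    show "u = 0" if "u \<in> E'" "\<forall>l\<in>F. l u = 0" for u
      using insert.prems(3) that by (simp add: E'_def zero_fun_def)
  qed
  then obtain B where B: "finite B" "\<not> fun_dependent B" "fun_span B = E'" "card B \<le> card F"
    by blast
  show ?case
  proof (cases "E' = E")
    case True
    then show ?thesis
      using B insert.hyps by (intro exI[of _ B]) auto
  next
    case False
    then obtain b where b: "b \<in> E" "l b \<noteq> 0"
      by (auto simp: E'_def)
    then have nb: "b \<notin> fun_span B"
      by (simp add: B(3) E'_def)
    then have "b \<notin> B"
      using fun_vs.span_base by blast
    have ind: "\<not> fun_dependent (insert b B)"
      using fun_vs.independent_insertI[OF nb] B(2) by blast
    have "u \<in> fun_span (insert b B) \<longleftrightarrow> u \<in> E" for u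
    proof
      assume "u \<in> fun_span (insert b B)"
      then obtain k where "u - (\<lambda>x. k * b x) \<in> E'"
        unfolding fun_vs.span_breakdown_eq B(3) by blast
      then have "u - (\<lambda>x. k * b x) \<in> E"
        by (simp add: E'_def)
      then have "(\<lambda>x. (u - (\<lambda>x. k * b x)) x + k * b x) \<in> E"
        by (rule E[OF _ b(1)])
      moreover have "(\<lambda>x. (u - (\<lambda>x. k * b x)) x + k * b x) = u"
        by (simp add: fun_eq_iff)
      ultimately show "u \<in> E"
        by argo
    next
      assume u: "u \<in> E"
      let ?k = "l u / l b"
      have "(\<lambda>x. u x + (- ?k) * b x) \<in> E'"
        using E[OF u b(1), of "- ?k"] lin[OF u b(1), of "- ?k"] b(2) by (simp add: E'_def)
      moreover have "(\<lambda>x. u x + (- ?k) * b x) = u - (\<lambda>x. ?k * b x)"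
        by (simp add: fun_eq_iff)
      ultimately show "u \<in> fun_span (insert b B)"
        unfolding fun_vs.span_breakdown_eq B(3) by (intro exI[of _ ?k]) argo
    qed
    then show ?thesis
      using B ind \<open>b \<notin> B\<close> insert.hyps by (intro exI[of _ "insert b B"]) auto
  qed
qed

text \<open>Adding the same integer to all three coefficients does not change the frequency, because the three
  basic vectors have sum 0. Every symmetric wave thus has a representative with last coefficient 0, and
  up to the phase these are finitely many for each eigenvalue.\<close>

lemma triangle_wave_shift: "triangle_wave j k l d = triangle_wave (j - l) (k - l) 0 d"
proof -
  have f: "freq (a - l) (b - l) (c - l) = freq a b c" for a b c
    by (simp add: freq_def)
  have z: "0 = l - l"
    by simp
  show ?thesis
    unfolding triangle_wave_eq[abs_def] z f ..
qed

lemma triangle_wave_phase: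
  "triangle_wave j k l d p = cos d * triangle_wave j k l 0 p + sin d * triangle_wave j k l (pi / 2) p"
  by (simp add: triangle_wave_eq cos_add algebra_simps)

text \<open>The norm of the Eisenstein integer \<open>j + k \<omega>\<close>; the eigenvalues are its values times \<open>eigen_unit\<close>.\<close>

definition eisenstein_norm :: "int \<Rightarrow> int \<Rightarrow> int"
  where "eisenstein_norm j k = j\<^sup>2 + k\<^sup>2 - j * k"

lemma eisenstein_norm_bound:
  fixes j k :: int
  shows "3 * j\<^sup>2 \<le> 4 * eisenstein_norm j k" "3 * k\<^sup>2 \<le> 4 * eisenstein_norm j k"
proof -
  have "4 * eisenstein_norm j k = (2 * k - j)\<^sup>2 + 3 * j\<^sup>2"
    by (simp add: eisenstein_norm_def power2_eq_square algebra_simps)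
  then show "3 * j\<^sup>2 \<le> 4 * eisenstein_norm j k"
    using zero_le_power2[of "2 * k - j"] by linarith
  have "4 * eisenstein_norm j k = (2 * j - k)\<^sup>2 + 3 * k\<^sup>2"
    by (simp add: eisenstein_norm_def power2_eq_square algebra_simps)
  then show "3 * k\<^sup>2 \<le> 4 * eisenstein_norm j k"
    using zero_le_power2[of "2 * j - k"] by linarith
qed

lemma eisenstein_norm_nonneg: "eisenstein_norm j k \<ge> 0"
  using eisenstein_norm_bound(1)[of j k] zero_le_power2[of j] by linarith

lemma abs_le_square_int: "\<bar>j\<bar> \<le> (j::int)\<^sup>2"
proof (cases "j = 0")
  case False
  then have "\<bar>j\<bar> * 1 \<le> \<bar>j\<bar> * \<bar>j\<bar>"
    by (intro mult_left_mono) auto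
  then show ?thesis
    by (simp add: power2_eq_square)
qed simp

lemma finite_eisenstein_norm_level: "finite {jk. eisenstein_norm (fst jk) (snd jk) = N}"
proof (rule finite_subset)
  show "{jk. eisenstein_norm (fst jk) (snd jk) = N} \<subseteq> {- 2 * N..2 * N} \<times> {- 2 * N..2 * N}"
  proof
    fix jk :: "int \<times> int" assume "jk \<in> {jk. eisenstein_norm (fst jk) (snd jk) = N}"
    then have "\<bar>fst jk\<bar> \<le> 2 * N" "\<bar>snd jk\<bar> \<le> 2 * N"
      using eisenstein_norm_bound[where j = "fst jk" and k = "snd jk"] abs_le_square_int[of "fst jk"] abs_le_square_int[of "snd jk"]
      by auto
    then show "jk \<in> {- 2 * N..2 * N} \<times> {- 2 * N..2 * N}"
      by (cases jk) auto
  qed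
qed simp

lemma triangle_mode_eigenvalue:
  "triangle_mode j k 0 d \<in> neumann_eigenspace equilateral_triangle (eigen_unit * of_int (eisenstein_norm j k))"
  using triangle_mode_in_eigenspace[of j k 0 d] by (simp add: eisenstein_norm_def)

lemma eigenspace_square_integrable:
  assumes "u \<in> neumann_eigenspace equilateral_triangle \<mu>"
  shows "square_integrable_on u equilateral_triangle"
proof -
  have "neumann_laplacian equilateral_triangle u (\<lambda>x. \<mu> * u x)"
    using assms by (simp add: neumann_eigenspace_eq[OF bounded_triangle triangle_borel])
  then obtain G where "H1 equilateral_triangle u G"
    unfolding neumann_laplacian_def by (elim conjE exE)
  then show ?thesis
    unfolding H1_def by (elim conjE)
qed

text \<open>Orthogonality to the symmetric waves for all other eigenvalues is automatic, and the two phases 0 and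
  \<open>\<pi>/2\<close> span all phases. So \<open>u\<close> is orthogonal to the whole algebra of symmetric waves.\<close>

lemma eigenspace_orthogonal_imp_zero:
  assumes u: "u \<in> neumann_eigenspace equilateral_triangle \<mu>"
    and orth: "\<And>j k d. \<mu> = eigen_unit * of_int (eisenstein_norm j k) \<Longrightarrow> d \<in> {0, pi / 2} \<Longrightarrow>
      (LINT p:equilateral_triangle|lborel. u p * triangle_mode j k 0 d p) = 0"
  shows "u = 0"
proof -
  let ?T = equilateral_triangle
  from u have c: "continuous_on ?T u" and z: "\<And>x. x \<notin> ?T \<Longrightarrow> u x = 0"
    and n: "neumann_laplacian ?T u (\<lambda>x. \<mu> * u x)"
    unfolding neumann_eigenspace_eq[OF bounded_triangle triangle_borel] by auto
  have sq: "square_integrable_on u ?T"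
    by (rule eigenspace_square_integrable[OF u])
  have mode: "(LINT p:?T|lborel. u p * triangle_mode j k 0 d p) = 0" if "d \<in> {0, pi / 2}" for j k d
  proof (cases "\<mu> = eigen_unit * of_int (eisenstein_norm j k)")
    case True
    then show ?thesis using orth that by blast
  next
    case False
    moreover have "neumann_laplacian ?T (triangle_mode j k 0 d) (\<lambda>x. (eigen_unit * of_int (eisenstein_norm j k)) * triangle_mode j k 0 d x)"
      using triangle_mode_eigenvalue[of j k d] unfolding neumann_eigenspace_eq[OF bounded_triangle triangle_borel] by auto
    ultimately show ?thesis
      using neumann_eigenfunctions_orthogonal[OF n] by blast
  qed
  have wave: "(LINT p:?T|lborel. u p * triangle_wave j k 0 d p) = 0" if "d \<in> {0, pi / 2}" for j k d
  proof -
    have "(LINT p:?T|lborel. u p * triangle_wave j k 0 d p) = (LINT p:?T|lborel. u p * triangle_mode j k 0 d p)"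
      using triangle_borel by (intro set_lebesgue_integral_cong) (auto simp: triangle_mode_def)
    then show ?thesis using mode[OF that] by simp
  qed
  have int: "set_integrable lborel ?T (\<lambda>p. u p * triangle_wave j k 0 d p)" for j k d
    by (rule square_integrable_product[OF sq square_integrable_on_continuous[OF bounded_triangle triangle_borel continuous_on_triangle_wave]])
  have "(LINT p:?T|lborel. u p * triangle_wave j k l d p) = 0" for j k l d
  proof -
    have phase: "triangle_wave j k l d p = cos d * triangle_wave (j - l) (k - l) 0 0 p + sin d * triangle_wave (j - l) (k - l) 0 (pi / 2) p" for p
      unfolding triangle_wave_shift[of j k l] by (rule triangle_wave_phase)
    have "(LINT p:?T|lborel. u p * triangle_wave j k l d p) =
        (LINT p:?T|lborel. cos d * (u p * triangle_wave (j - l) (k - l) 0 0 p) + sin d * (u p * triangle_wave (j - l) (k - l) 0 (pi / 2) p))"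
      unfolding phase by (simp only: distrib_left mult.left_commute[of "u _"])
    also have "\<dots> = cos d * (LINT p:?T|lborel. u p * triangle_wave (j - l) (k - l) 0 0 p)
        + sin d * (LINT p:?T|lborel. u p * triangle_wave (j - l) (k - l) 0 (pi / 2) p)"
      using int by simp
    finally show ?thesis
      using wave by simp
  qed
  then have "u x = 0" if "x \<in> ?T" for x
    using orthogonal_to_waves_imp_zero[OF c sq] that by blast
  with z show ?thesis
    by (auto simp: fun_eq_iff)
qed

lemma mode_functional_linear:
  assumes "u \<in> neumann_eigenspace equilateral_triangle \<mu>" "v \<in> neumann_eigenspace equilateral_triangle \<mu>"
  shows "(LINT p:equilateral_triangle|lborel. (u p + c * v p) * triangle_mode j k l d p) =
    (LINT p:equilateral_triangle|lborel. u p * triangle_mode j k l d p) + c * (LINT p:equilateral_triangle|lborel. v p * triangle_mode j k l d p)"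
proof -
  have int: "set_integrable lborel equilateral_triangle (\<lambda>p. w p * triangle_mode j k l d p)"
    if "w \<in> neumann_eigenspace equilateral_triangle \<mu>" for w
    using eigenspace_square_integrable[OF that] eigenspace_square_integrable[OF triangle_mode_in_eigenspace[of j k l d]]
    by (rule square_integrable_product)
  have "(LINT p:equilateral_triangle|lborel. (u p + c * v p) * triangle_mode j k l d p) =
      (LINT p:equilateral_triangle|lborel. u p * triangle_mode j k l d p + c * (v p * triangle_mode j k l d p))"
    by (simp add: algebra_simps)
  then show ?thesis
    using int[OF assms(1)] int[OF assms(2)] by simp
qed

lemma eigen_unit_pos: "eigen_unit > 0"
  by (simp add: eigen_unit_def)

lemma eigenspace_finite_basis:
  "\<exists>B. finite B \<and> \<not> fun_dependent B \<and> fun_span B = neumann_eigenspace equilateral_triangle \<mu>"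
proof -
  let ?l = "\<lambda>(jk, d) u. LINT p:equilateral_triangle|lborel. u p * triangle_mode (fst jk) (snd jk) 0 d p"
  let ?J = "{jk. \<mu> = eigen_unit * of_int (eisenstein_norm (fst jk) (snd jk))} \<times> {0, pi / 2}"
  have "{jk. \<mu> = eigen_unit * of_int (eisenstein_norm (fst jk) (snd jk))} \<subseteq>
      {jk. eisenstein_norm (fst jk) (snd jk) = \<lfloor>\<mu> / eigen_unit\<rfloor>}"
    using eigen_unit_pos by auto
  then have "finite ?J"
    using finite_subset[OF _ finite_eisenstein_norm_level] by blast
  have "\<exists>B. finite B \<and> \<not> fun_dependent B \<and> fun_span B = neumann_eigenspace equilateral_triangle \<mu> \<and> card B \<le> card (?l ` ?J)"
  proof (rule finite_basis_from_separating_functionals)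
    show "finite (?l ` ?J)"
      using \<open>finite ?J\<close> by blast
    show "fun_vs.subspace (neumann_eigenspace equilateral_triangle \<mu>)"
      by (rule subspace_neumann_eigenspace[OF bounded_triangle triangle_borel])
    show "l (\<lambda>x. u x + c * v x) = l u + c * l v"
      if "l \<in> ?l ` ?J" "u \<in> neumann_eigenspace equilateral_triangle \<mu>" "v \<in> neumann_eigenspace equilateral_triangle \<mu>" for l u v c
      using that(1) mode_functional_linear[OF that(2,3)] by auto
    show "u = 0" if "u \<in> neumann_eigenspace equilateral_triangle \<mu>" "\<forall>l\<in>?l ` ?J. l u = 0" for u
    proof (rule eigenspace_orthogonal_imp_zero[OF that(1)])
      fix j k and d :: real
      assume "\<mu> = eigen_unit * of_int (eisenstein_norm j k)" "d \<in> {0, pi / 2}"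
      then have "((j, k), d) \<in> ?J"
        by simp
      from bspec[OF that(2) imageI[where f = ?l, OF this]]
      show "(LINT p:equilateral_triangle|lborel. u p * triangle_mode j k 0 d p) = 0"
        by simp
    qed
  qed
  then show ?thesis by blast
qed

definition eigenvalue_multiplicity :: "real \<Rightarrow> nat"
  where "eigenvalue_multiplicity \<mu> = fun_vs.dim (neumann_eigenspace equilateral_triangle \<mu>)"

lemma span_eigenspace: "fun_span (neumann_eigenspace equilateral_triangle \<mu>) = neumann_eigenspace equilateral_triangle \<mu>"
  using subspace_neumann_eigenspace[OF bounded_triangle triangle_borel] by (simp add: fun_vs.span_eq_iff)

lemma eigenvalue_multiplicity_eq_card:
  assumes "\<not> fun_dependent B" "fun_span B = neumann_eigenspace equilateral_triangle \<mu>"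
  shows "card B = eigenvalue_multiplicity \<mu>"
  unfolding eigenvalue_multiplicity_def
  by (rule fun_vs.dim_eq_card[symmetric]) (simp_all add: assms span_eigenspace)

lemma origin_in_closure_triangle: "(0, 0) \<in> closure equilateral_triangle"
proof -
  let ?H = "convex hull {(0, 0), (1, 0), (1/2, sqrt 3 / 2) :: real \<times> real}"
  have "1/4 < sqrt 3 * (1/2)"
  proof -
    have "1 \<le> sqrt 3"
      by simp
    then show ?thesis
      by linarith
  qed
  then have "(1/2, 1/4) \<in> equilateral_triangle"
    by (simp add: in_triangle_iff)
  then have "interior ?H \<noteq> {}"
    unfolding equilateral_triangle_def by blast
  then have "closure equilateral_triangle = closure ?H"
    unfolding equilateral_triangle_def by (intro convex_closure_interior) simp
  moreover have "(0, 0) \<in> ?H"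
    by (rule hull_inc) simp
  ultimately show ?thesis
    using closure_subset by blast
qed

text \<open>At the origin all six cosines are 1. The origin is a vertex of the triangle, so the value 6 is
  approached from inside.\<close>

lemma triangle_mode_nonzero: "\<exists>p\<in>equilateral_triangle. triangle_mode j k l 0 p \<noteq> 0"
proof (rule ccontr)
  assume "\<not> ?thesis"
  then have z: "triangle_wave j k l 0 p = 0" if "p \<in> equilateral_triangle" for p
    using that by (auto simp: triangle_mode_def)
  have "triangle_wave j k l 0 (0, 0) = 0"
    by (rule continuous_constant_on_closure[OF continuous_on_triangle_wave z origin_in_closure_triangle])
  then show False
    by (simp add: triangle_wave_eq freq_def)
qed

lemma eigenvalue_multiplicity_pos: "eigenvalue_multiplicity (eigen_unit * of_int (eisenstein_norm j k)) > 0"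
proof -
  let ?\<mu> = "eigen_unit * of_int (eisenstein_norm j k)"
  obtain B where B: "finite B" "\<not> fun_dependent B" "fun_span B = neumann_eigenspace equilateral_triangle ?\<mu>"
    using eigenspace_finite_basis by blast
  have "triangle_mode j k 0 0 \<noteq> 0"
    using triangle_mode_nonzero[of j k 0] by auto
  then have "B \<noteq> {}"
    using B(3) triangle_mode_eigenvalue[of j k 0] fun_vs.span_empty by auto
  then show ?thesis
    using eigenvalue_multiplicity_eq_card[OF B(2,3)] B(1) by (metis card_gt_0_iff)
qed

text \<open>The norm form vanishes only at the origin, so the inner product with a constant separates
  the eigenspace of 0.\<close>

lemma eigenvalue_multiplicity_zero: "eigenvalue_multiplicity 0 = 1"
proof -
  let ?l = "\<lambda>u. LINT p:equilateral_triangle|lborel. u p * triangle_mode 0 0 0 0 p"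
  have "\<exists>B. finite B \<and> \<not> fun_dependent B \<and> fun_span B = neumann_eigenspace equilateral_triangle 0 \<and> card B \<le> card {?l}"
  proof (rule finite_basis_from_separating_functionals)
    show "fun_vs.subspace (neumann_eigenspace equilateral_triangle 0)"
      by (rule subspace_neumann_eigenspace[OF bounded_triangle triangle_borel])
    show "l (\<lambda>x. u x + c * v x) = l u + c * l v"
      if "l \<in> {?l}" "u \<in> neumann_eigenspace equilateral_triangle 0" "v \<in> neumann_eigenspace equilateral_triangle 0" for l u v c
      using that(1) mode_functional_linear[OF that(2,3)] by auto
    show "u = 0" if "u \<in> neumann_eigenspace equilateral_triangle 0" "\<forall>l\<in>{?l}. l u = 0" for u
    proof (rule eigenspace_orthogonal_imp_zero[OF that(1)])
      fix j k and d :: real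
      assume 0: "0 = eigen_unit * of_int (eisenstein_norm j k)" and d: "d \<in> {0, pi / 2}"
      from 0 have "eisenstein_norm j k = 0"
        using eigen_unit_pos by simp
      then have jk: "j = 0" "k = 0"
        using eisenstein_norm_bound[where j = j and k = k] by auto
      have vanish: "triangle_mode 0 0 0 (pi / 2) p = 0" for p
        by (cases p) (simp add: triangle_mode_def triangle_wave_eq freq_def)
      consider "d = 0" | "d = pi / 2"
        using d by blast
      then show "(LINT p:equilateral_triangle|lborel. u p * triangle_mode j k 0 d p) = 0"
      proof cases
        case 1
        then show ?thesis
          using that(2) jk by simp
      next
        case 2
        show ?thesis
          unfolding jk 2 vanish by (simp add: set_lebesgue_integral_def)
      qed
    qed
  qed simp
  then have "eigenvalue_multiplicity 0 \<le> 1"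
    using eigenvalue_multiplicity_eq_card by auto
  moreover have "eigenvalue_multiplicity 0 > 0"
    using eigenvalue_multiplicity_pos[of 0 0] by (simp add: eisenstein_norm_def)
  ultimately show ?thesis by simp
qed

lemma eigenvalue_multiplicity_other:
  assumes "\<And>q::nat. \<mu> \<noteq> eigen_unit * real q"
  shows "neumann_eigenspace equilateral_triangle \<mu> = {0}"
proof -
  have "u = 0" if "u \<in> neumann_eigenspace equilateral_triangle \<mu>" for u
  proof (rule eigenspace_orthogonal_imp_zero[OF that])
    fix j k and d :: real
    assume "\<mu> = eigen_unit * of_int (eisenstein_norm j k)"
    then have "\<mu> = eigen_unit * real (nat (eisenstein_norm j k))"
      using eisenstein_norm_nonneg[of j k] by simp
    with assms show "(LINT p:equilateral_triangle|lborel. u p * triangle_mode j k 0 d p) = 0"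
      by blast
  qed
  then show ?thesis
    by (auto simp: neumann_eigenspace_def)
qed

text \<open>The value \<open>q\<close> is listed in a block of length \<open>d q\<close>, placed after the blocks of all smaller values.
  Infinitely many nonempty blocks are required for the listing to be defined at every index.\<close>

lemma listing_with_multiplicities:
  fixes d :: "nat \<Rightarrow> nat"
  assumes inf: "infinite {q. d q > 0}"
  shows "\<exists>l. mono l \<and> (\<forall>q. {k. l k = q} = {sum d {..<q}..<sum d {..<Suc q}})"
proof -
  define D where "D q = sum d {..<q}" for q
  have D_Suc: "D (Suc q) = D q + d q" for q
    by (simp add: D_def)
  have D_mono: "D q \<le> D r" if "q \<le> r" for q r
    unfolding D_def using that by (intro sum_mono2) auto
  have unbounded: "\<exists>q. k < D (Suc q)" for k
  proof (induction k)
    case 0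
    obtain q where "d q > 0"
      using inf by (metis (mono_tags, lifting) empty_Collect_eq finite.emptyI)
    then show ?case
      by (auto simp: D_Suc intro!: exI[of _ q])
  next
    case (Suc k)
    then obtain q where q: "k < D (Suc q)" by blast
    obtain r where r: "r > q" "d r > 0"
      using inf unfolding infinite_nat_iff_unbounded by auto
    have "D (Suc q) \<le> D r"
      using r(1) by (intro D_mono) simp
    then have "Suc k < D (Suc r)"
      using q r(2) by (simp add: D_Suc)
    then show ?case ..
  qed
  define l where "l k = (LEAST q. k < D (Suc q))" for k
  have l1: "k < D (Suc (l k))" for k
    unfolding l_def using unbounded[of k] by (rule LeastI_ex)
  have l2: "l k \<le> q" if "k < D (Suc q)" for k q
    unfolding l_def using that by (rule Least_le)
  have l3: "D (l k) \<le> k" for k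
  proof (cases "l k")
    case 0
    then show ?thesis by (simp add: D_def)
  next
    case (Suc q)
    then show ?thesis
      using l2[of k q] by (metis Suc_n_not_le_n not_less)
  qed
  have "mono l"
  proof (rule monoI)
    fix k k' :: nat assume "k \<le> k'"
    then show "l k \<le> l k'"
      using l1[of k'] by (intro l2) simp
  qed
  moreover have "l k = q \<longleftrightarrow> D q \<le> k \<and> k < D (Suc q)" for k q
  proof
    assume "D q \<le> k \<and> k < D (Suc q)"
    then have "l k \<le> q" "\<not> Suc (l k) \<le> q"
      using l2 l1[of k] D_mono[of "Suc (l k)" q] by auto
    then show "l k = q" by simp
  qed (use l1 l3 in auto)
  ultimately show ?thesis
    unfolding D_def by (intro exI[of _ l]) auto
qed

lemma triangle_eigenvalue_listing:
  "\<exists>lam. neumann_eigenvalue_listing equilateral_triangle lam \<and> lam 1 = 0 \<and> lam 2 = eigen_unit"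
proof -
  define d where "d q = eigenvalue_multiplicity (eigen_unit * real q)" for q
  \<comment> \<open>the coefficients \<open>(j, 0)\<close> provide infinitely many eigenvalues\<close>
  have "inj (\<lambda>j::nat. j\<^sup>2)"
    by (rule injI) simp
  then have "infinite (range (\<lambda>j::nat. j\<^sup>2))"
    using finite_imageD by blast
  moreover have "range (\<lambda>j::nat. j\<^sup>2) \<subseteq> {q. d q > 0}"
  proof clarify
    fix j :: nat
    show "d (j\<^sup>2) > 0"
      using eigenvalue_multiplicity_pos[of "int j" 0] by (simp add: d_def eisenstein_norm_def)
  qed
  ultimately have "infinite {q. d q > 0}"
    using infinite_super by blast
  then obtain l where l: "mono l" "\<And>q. {k. l k = q} = {sum d {..<q}..<sum d {..<Suc q}}"
    using listing_with_multiplicities by blast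
  define lam where "lam k = eigen_unit * real (l (k - 1))" for k
  have level: "{k. 1 \<le> k \<and> lam k = eigen_unit * real q} = Suc ` {k. l k = q}" for q
  proof -
    have "k \<in> Suc ` {k. l k = q}" if "1 \<le> k" "l (k - 1) = q" for k
      using image_eqI[of k Suc "k - 1"] that by simp
    then show ?thesis
      using eigen_unit_pos by (auto simp: lam_def)
  qed
  have "neumann_eigenvalue_listing equilateral_triangle lam"
    unfolding neumann_eigenvalue_listing_def
  proof (intro conjI allI)
    show "mono_on {1..} lam"
      using l(1) eigen_unit_pos by (auto simp: mono_on_def lam_def mono_def diff_le_mono)
    fix \<mu>
    have "finite {k. 1 \<le> k \<and> lam k = \<mu>} \<and> card {k. 1 \<le> k \<and> lam k = \<mu>} = eigenvalue_multiplicity \<mu>"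
    proof (cases "\<exists>q::nat. \<mu> = eigen_unit * real q")
      case True
      then obtain q :: nat where q: "\<mu> = eigen_unit * real q" by blast
      show ?thesis
        unfolding q level l(2) by (simp add: card_image d_def[symmetric])
    next
      case False
      then have "{k. 1 \<le> k \<and> lam k = \<mu>} = {}"
        by (auto simp: lam_def)
      moreover have "eigenvalue_multiplicity \<mu> = 0"
        using eigenvalue_multiplicity_eq_card[of "{}" \<mu>] eigenvalue_multiplicity_other[of \<mu>] False fun_vs.independent_empty fun_vs.span_empty
        by auto
      ultimately show ?thesis
        by (metis card.empty finite.emptyI)
    qed
    moreover obtain B where "finite B" "\<not> fun_dependent B" "fun_span B = neumann_eigenspace equilateral_triangle \<mu>"
      using eigenspace_finite_basis by blast
    ultimately show "finite {k. 1 \<le> k \<and> lam k = \<mu>}"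
      "\<exists>B. finite B \<and> \<not> fun_dependent B \<and> fun_span B = neumann_eigenspace equilateral_triangle \<mu> \<and>
        card B = card {k. 1 \<le> k \<and> lam k = \<mu>}"
      using eigenvalue_multiplicity_eq_card by auto
  qed
  moreover have d0: "d 0 = 1"
    by (simp add: d_def eigenvalue_multiplicity_zero)
  have d1: "d 1 > 0"
    using eigenvalue_multiplicity_pos[of 1 0] by (simp add: d_def eisenstein_norm_def)
  \<comment> \<open>the indices of \<open>l\<close> start at 0: its first block has length 1, and the second one is nonempty\<close>
  have "0 \<in> {k. l k = 0}" "1 \<in> {k. l k = 1}"
    unfolding l(2) using d0 d1 by (simp_all add: lessThan_Suc)
  then have "lam 1 = 0" "lam 2 = eigen_unit"
    by (simp_all add: lam_def)
  ultimately show ?thesis by blast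
qed

section \<open>A combination with three nodal domains\<close>

lemma neumann_eigenfunction_triangle_mode:
  "neumann_eigenfunction equilateral_triangle (eigen_unit * of_int (eisenstein_norm j k)) (triangle_mode j k 0 0)"
proof -
  have "triangle_mode j k 0 0 \<noteq> 0"
    using triangle_mode_nonzero[of j k 0] by auto
  then show ?thesis
    using triangle_mode_eigenvalue[of j k 0] unfolding neumann_eigenspace_def by blast
qed

definition corner_cutting_wave :: "real \<times> real \<Rightarrow> real"
  where "corner_cutting_wave p = 1/2 * triangle_wave 1 0 0 0 p + 1/6 * triangle_wave 0 0 0 0 p"

definition corner_cutting_mode :: "real \<times> real \<Rightarrow> real"
  where "corner_cutting_mode p = 1/2 * triangle_mode 1 0 0 0 p + 1/6 * triangle_mode 0 0 0 0 p"

lemma corner_cutting_mode_eq: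
  "p \<in> equilateral_triangle \<Longrightarrow> corner_cutting_mode p = corner_cutting_wave p"
  by (simp add: corner_cutting_mode_def corner_cutting_wave_def triangle_mode_def)

text \<open>With \<open>A = 2\<pi>x/3\<close> and \<open>B = 2\<pi>y/\<surd>3\<close> the three phases of the wave are \<open>A + B\<close>, \<open>A - B\<close> and \<open>-2A\<close>.\<close>

lemma corner_cutting_wave_factors:
  "corner_cutting_wave (x, y) = 2 * cos (2 * pi / 3 * x) * (cos (2 * pi / 3 * x) + cos (2 * pi / 3 * (sqrt 3 * y)))"
proof -
  let ?A = "2 * pi / 3 * x" and ?B = "2 * pi / 3 * (sqrt 3 * y)"
  have f: "freq 1 0 0 \<bullet> (x, y) = ?A + ?B" "freq 0 1 0 \<bullet> (x, y) = ?A - ?B" "freq 0 0 1 \<bullet> (x, y) = - (2 * ?A)"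
    "freq 0 0 0 \<bullet> (x, y) = 0"
    by (simp_all add: freq_def field_simps)
  have "corner_cutting_wave (x, y) = cos (?A + ?B) + cos (?A - ?B) + cos (2 * ?A) + 1"
    unfolding corner_cutting_wave_def triangle_wave_eq f by simp
  also have "\<dots> = 2 * cos ?A * (cos ?A + cos ?B)"
    unfolding cos_add cos_diff cos_double_cos by (simp add: power2_eq_square algebra_simps)
  finally show ?thesis .
qed

lemma corner_cutting_mode_in_span:
  assumes "L \<ge> eigen_unit"
  shows "corner_cutting_mode \<in> eigen_combinations equilateral_triangle L"
proof -
  let ?S = "{u. \<exists>\<mu>\<le>L. neumann_eigenfunction equilateral_triangle \<mu> u}"
  have "neumann_eigenfunction equilateral_triangle eigen_unit (triangle_mode 1 0 0 0)"
    "neumann_eigenfunction equilateral_triangle 0 (triangle_mode 0 0 0 0)"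
    using neumann_eigenfunction_triangle_mode[of 1 0] neumann_eigenfunction_triangle_mode[of 0 0]
    by (simp_all add: eisenstein_norm_def)
  moreover have "0 \<le> L"
    using assms eigen_unit_pos by linarith
  ultimately have S: "triangle_mode 1 0 0 0 \<in> ?S" "triangle_mode 0 0 0 0 \<in> ?S"
    using assms by blast+
  have "(\<lambda>p. 1/2 * triangle_mode 1 0 0 0 p) + (\<lambda>p. 1/6 * triangle_mode 0 0 0 0 p) \<in> fun_span ?S"
    using S by (intro fun_vs.span_add fun_vs.span_scale fun_vs.span_base)
  moreover have "(\<lambda>p. 1/2 * triangle_mode 1 0 0 0 p) + (\<lambda>p. 1/6 * triangle_mode 0 0 0 0 p) = corner_cutting_mode"
    by (simp add: fun_eq_iff corner_cutting_mode_def)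
  ultimately show ?thesis
    unfolding eigen_combinations_def by argo
qed

lemma corner_cutting_mode_zero_on_lines:
  assumes "p \<in> equilateral_triangle" "p \<bullet> (1, 0) = 3/4 \<or> p \<bullet> (1, sqrt 3) = 3/2"
  shows "corner_cutting_mode p = 0"
proof -
  obtain x y where p: "p = (x, y)" by (cases p)
  from assms(2) consider "x = 3/4" | "x + sqrt 3 * y = 3/2"
    by (auto simp: p mult.commute)
  then have "corner_cutting_wave (x, y) = 0"
  proof cases
    case 1
    then have right_angle: "2 * pi / 3 * x = pi / 2" by simp
    show ?thesis
      unfolding corner_cutting_wave_factors right_angle by simp
  next
    case 2
    have "2 * pi / 3 * x + 2 * pi / 3 * (sqrt 3 * y) = 2 * pi / 3 * (x + sqrt 3 * y)"
      by (simp only: distrib_left)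
    then have supplementary: "2 * pi / 3 * (sqrt 3 * y) = pi - 2 * pi / 3 * x"
      unfolding 2 by simp
    show ?thesis
      unfolding corner_cutting_wave_factors supplementary by simp
  qed
  then show ?thesis
    using corner_cutting_mode_eq[OF assms(1)] p by simp
qed

text \<open>Taking the closure adds no points inside the triangle, since the mode extends continuously to the
  plane.\<close>

lemma notin_nodal_set:
  assumes "p \<in> equilateral_triangle" "corner_cutting_wave p \<noteq> 0"
  shows "p \<in> equilateral_triangle - nodal_set equilateral_triangle corner_cutting_mode"
proof -
  have "closed {p. corner_cutting_wave p = 0}"
    unfolding corner_cutting_wave_def
    by (intro closed_Collect_eq continuous_intros continuous_on_triangle_wave)
  moreover have "{x \<in> equilateral_triangle. corner_cutting_mode x = 0} \<subseteq> {p. corner_cutting_wave p = 0}"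
    using corner_cutting_mode_eq by auto
  ultimately have "nodal_set equilateral_triangle corner_cutting_mode \<subseteq> {p. corner_cutting_wave p = 0}"
    unfolding nodal_set_def by (rule closure_minimal[rotated])
  then show ?thesis
    using assms by blast
qed

lemma components_card_ge_3:
  assumes p: "p \<in> X" "q \<in> X" "r \<in> X"
    and "\<not> connected_component X p q" "\<not> connected_component X p r" "\<not> connected_component X q r"
    and "finite (components X)"
  shows "3 \<le> card (components X)"
proof -
  let ?c = "connected_component_set X"
  have "?c p \<noteq> ?c q" "?c p \<noteq> ?c r" "?c q \<noteq> ?c r"
    using assms connected_component_refl[OF p(2)] connected_component_refl[OF p(3)]
    by (metis mem_Collect_eq)+
  then have "card {?c p, ?c q, ?c r} = 3"
    by simp
  moreover have "{?c p, ?c q, ?c r} \<subseteq> components X"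
    using p by (auto simp: components_def)
  ultimately show ?thesis
    using card_mono[OF assms(7)] by metis
qed

text \<open>A connected set that meets both sides of a hyperplane meets the hyperplane.\<close>

lemma separated_by_line:
  fixes p q k :: "'a::euclidean_space"
  assumes "\<And>z. z \<in> X \<Longrightarrow> z \<bullet> k \<noteq> a" "p \<bullet> k \<le> a" "a \<le> q \<bullet> k"
  shows "\<not> connected_component X p q"
proof
  assume "connected_component X p q"
  then obtain C where C: "connected C" "C \<subseteq> X" "p \<in> C" "q \<in> C"
    unfolding connected_component_def by blast
  obtain z where "z \<in> C" "z \<bullet> k = a"
    using connected_ivt_hyperplane[OF C(1,3,4), of k a] assms(2,3) by (auto simp: inner_commute)
  then show False
    using assms(1) C(2) by blast
qed

text \<open>The centre of the triangle and one point in each of the two corners that are cut off lie in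
  different components: any two of them are separated by one of the two lines.\<close>

lemma corner_cutting_mode_nodal_domains:
  "beta0 equilateral_triangle corner_cutting_mode \<ge> 3"
proof -
  let ?T = equilateral_triangle
  define X where "X = ?T - nodal_set ?T corner_cutting_mode"
  have X1: "z \<bullet> (1, 0) \<noteq> 3/4" and X2: "z \<bullet> (1, sqrt 3) \<noteq> 3/2" if "z \<in> X" for z
  proof -
    have "z \<in> ?T" "corner_cutting_mode z \<noteq> 0"
      using that closure_subset[of "{x \<in> ?T. corner_cutting_mode x = 0}"]
      unfolding X_def nodal_set_def by blast+
    then show "z \<bullet> (1, 0) \<noteq> 3/4" "z \<bullet> (1, sqrt 3) \<noteq> 3/2"
      using corner_cutting_mode_zero_on_lines by blast+
  qed
  have s3: "sqrt 3 > 1"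
    by simp
  define p q r :: "real \<times> real" where "p = (1/2, sqrt 3 / 6)" and "q = (9/10, sqrt 3 / 100)" and "r = (1/2, sqrt 3 * 2 / 5)"
  have "p \<in> X"
    unfolding X_def
  proof (rule notin_nodal_set)
    show "p \<in> ?T"
      using s3 by (simp add: p_def in_triangle_iff)
    have "2 * pi / 3 * (1 / 2) = pi / 3" "2 * pi / 3 * (sqrt 3 * (sqrt 3 / 6)) = pi / 3"
      by simp_all
    then show "corner_cutting_wave p \<noteq> 0"
      unfolding p_def corner_cutting_wave_factors by (simp add: cos_60)
  qed
  have "q \<in> X"
    unfolding X_def
  proof (rule notin_nodal_set)
    show "q \<in> ?T"
      using s3 by (simp add: q_def in_triangle_iff)
    have A: "2 * pi / 3 * (9 / 10) = 3 * pi / 5" and B: "2 * pi / 3 * (sqrt 3 * (sqrt 3 / 100)) = pi / 50"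
      by simp_all
    have "cos (3 * pi / 5) < cos (pi / 2)"
      by (rule cos_monotone_0_pi) (use pi_gt_zero in auto)
    moreover have "cos (pi - 3 * pi / 5) < cos (pi / 50)"
      by (rule cos_monotone_0_pi) (use pi_gt_zero in auto)
    then have "cos (3 * pi / 5) + cos (pi / 50) > 0"
      using cos_pi_minus[of "3 * pi / 5"] by linarith
    ultimately show "corner_cutting_wave q \<noteq> 0"
      unfolding q_def corner_cutting_wave_factors A B by simp
  qed
  have "r \<in> X"
    unfolding X_def
  proof (rule notin_nodal_set)
    show "r \<in> ?T"
      using s3 by (simp add: r_def in_triangle_iff)
    have A: "2 * pi / 3 * (1 / 2) = pi / 3" and B: "2 * pi / 3 * (sqrt 3 * (sqrt 3 * 2 / 5)) = 4 * pi / 5"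
      by simp_all
    have "cos (4 * pi / 5) < cos (pi - pi / 3)"
      by (rule cos_monotone_0_pi) (use pi_gt_zero in auto)
    then have "cos (pi / 3) + cos (4 * pi / 5) < 0"
      using cos_pi_minus[of "pi / 3"] by linarith
    then show "corner_cutting_wave r \<noteq> 0"
      unfolding r_def corner_cutting_wave_factors A B by (simp add: cos_60)
  qed
  have "\<not> connected_component X p q"
    by (rule separated_by_line[OF X1]) (simp_all add: p_def q_def)
  moreover have "\<not> connected_component X p r"
    by (rule separated_by_line[OF X2]) (simp_all add: p_def r_def mult.commute)
  moreover have "\<not> connected_component X r q"
    by (rule separated_by_line[OF X1]) (simp_all add: r_def q_def)
  then have "\<not> connected_component X q r"
    using connected_component_sym by metis
  ultimately have "finite (components X) \<Longrightarrow> 3 \<le> card (components X)"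
    by (intro components_card_ge_3[OF \<open>p \<in> X\<close> \<open>q \<in> X\<close> \<open>r \<in> X\<close>])
  then show ?thesis
    unfolding beta0_def X_def[symmetric] Let_def by (auto simp: numeral_eq_enat)
qed

theorem proposition3p1:
  shows "\<not> neumann_ECP equilateral_triangle
    \<and> (\<exists>lam m v. neumann_eigenvalue_listing equilateral_triangle lam \<and> 1 \<le> m
        \<and> v \<in> eigen_combinations equilateral_triangle (lam m)
        \<and> beta0 equilateral_triangle v > enat (kappa lam (lam m)))"
proof -
  obtain lam where lam: "neumann_eigenvalue_listing equilateral_triangle lam" "lam 1 = 0" "lam 2 = eigen_unit"
    using triangle_eigenvalue_listing by blast
  have "kappa lam (lam 2) = 2"
    unfolding kappa_def
  proof (rule Least_equality)
    fix k :: nat assume k: "1 \<le> k \<and> lam k = lam 2"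
    then have "k \<noteq> 1"
      using lam(2,3) eigen_unit_pos by auto
    with k show "2 \<le> k" by simp
  qed simp
  moreover have "corner_cutting_mode \<in> eigen_combinations equilateral_triangle (lam 2)"
    by (rule corner_cutting_mode_in_span) (simp add: lam(3))
  moreover have "enat 2 < beta0 equilateral_triangle corner_cutting_mode"
    by (rule less_le_trans[OF _ corner_cutting_mode_nodal_domains]) (simp add: numeral_eq_enat)
  ultimately have violation: "neumann_eigenvalue_listing equilateral_triangle lam" "1 \<le> (2::nat)"
    "corner_cutting_mode \<in> eigen_combinations equilateral_triangle (lam 2)"
    "beta0 equilateral_triangle corner_cutting_mode > enat (kappa lam (lam 2))"
    using lam(1) by simp_all
  then have "\<not> neumann_ECP equilateral_triangle"
    unfolding neumann_ECP_def by (metis not_less)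
  with violation show ?thesis by blast
qed

end
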